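(* There exist a shear type homeomorphism $f$ of the torus $\mathrm{T}^2$ and a periodic orbit $x$ of $f$ such that $x$ is of twist type but is not a simple orbit.
   Context: **Shear homeomorphisms, axes.** A homeomorphism of $\mathrm{T}^2$ is of shear type if it is isotopic to one Dehn twist along a single closed curve. For such a homeomorphism there is a basis (horizontal class, vertical class) of $H_1(\mathrm{T}^2;\mathbb{Z})$ in which the induced map is $\begin{pmatrix}1&0\\1&1\end{pmatrix}$ (the horizontal class goes to horizontal plus vertical, the vertical class is fixed). Axes given by such a basis are called standard axes; fix a choice of them. "Vertical" refers to the direction along which the twist is made; "forwards" refers to the positive horizontal direction. **Rotation number.** Let $h$ be of shear type, $\hat h$ a lift of $h$ to the universal cover $\mathbb{R}^2$, and $x$ a periodic point of period $p$. Then $\hat h^p$ moves every lift $\hat x$ of $x$ by the same integer $q$ along the horizontal axis (and possibly by an integer along the vertical axis). The rotation number is $\rho(x)=\frac qp \bmod 1\in[0,1)$; it does not depend on the lift and is the same for all points of an orbit. **Similarity (type).** Orbits $(x,f)$ and $(y,g)$ are similar (of the same type) if there is a homeomorphism $h$ of $\mathrm{T}^2$, isotopic to the identity, which takes the orbit $x$ onto the orbit $y$ and such that $hfh^{-1}$ is isotopic to $g$ rel $y$. **Forcing, twist type.** A periodic orbit $(x,f)$ forces a type of periodic orbit if every homeomorphism isotopic to $f$ rel $x$ has a periodic orbit of that type. A periodic orbit is of twist type if it does not force the existence of any orbit of a different type (i.e. not similar to it) with the same rotation number. **The graph $G_N$.** $G_N$ is the graph obtained from the unit circle by attaching $N$ loops,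 one at each of the points $\exp(2\pi i j/N)$, $j=0,\dots,N-1$. In every embedding of $G_N$ in the torus considered here, the circle is a simple closed curve in the horizontal direction (the horizontal loop), and the attached loops are pairwise disjoint simple closed curves in the vertical direction (the vertical loops), each crossing the horizontal loop once; they are cyclically ordered along the horizontal loop, and the complement in $\mathrm{T}^2$ of the embedded graph consists of $N$ open topological rectangles. **Simple orbit.** A periodic orbit $x=\{x_1,\dots,x_N\}$ ($N$ distinct points) of a shear homeomorphism $f$ is a simple orbit if: (1) there is a graph $G$ homeomorphic to $G_N$, embedded in $\mathrm{T}^2$ with its circle as a horizontal loop and its $N$ attached loops as pairwise disjoint vertical loops each crossing the horizontal loop once, which is a deformation retract of $\mathrm{T}_0=\mathrm{T}^2\setminus x$ (so each complementary rectangle contains exactly one point of $x$); (2) there is a homeomorphism $\tilde f$ isotopic to $f$ rel $x$ such that a neighborhood of $G$ is $\tilde f$-invariant and the induced action on $G$ satisfies: (a) there is a fixed $k\in\{0,\dots,N-1\}$ such that each vertical loop is mapped to the vertical loop $k$ places forwards; (b) the horizontal loop is mapped to itself with one (Dehn) twist around one of the vertical loops. *)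

theory Defs
  imports "HOL-Analysis.Analysis"
begin

text \<open>Functions and isotopies are only relevant on the torus;
  their values elsewhere on the type are arbitrary.\<close>

type_synonym torus_pt = "complex \<times> complex"

definition torus :: "torus_pt set" where
  "torus = sphere 0 1 \<times> sphere 0 1"

definition torus_cover :: "real \<times> real \<Rightarrow> torus_pt" where
  "torus_cover v = (cis (2 * pi * fst v), cis (2 * pi * snd v))"

definition torus_homeo :: "(torus_pt \<Rightarrow> torus_pt) \<Rightarrow> bool" where
  "torus_homeo f \<longleftrightarrow> (\<exists>g. homeomorphism torus torus f g)"

text \<open>For a finite set \<open>x\<close> that \<open>f\<close> preserves, an isotopy through maps preserving \<open>x\<close> is
  constant on \<open>x\<close>.\<close>

definition isotopic_rel ::
    "torus_pt set \<Rightarrow> (torus_pt \<Rightarrow> torus_pt) \<Rightarrow> (torus_pt \<Rightarrow> torus_pt) \<Rightarrow> bool" where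
  "isotopic_rel x f g \<longleftrightarrow>
     homotopic_with_canon (\<lambda>\<phi>. torus_homeo \<phi> \<and> (\<forall>z\<in>x. \<phi> z = f z)) torus torus f g"

abbreviation isotopic :: "(torus_pt \<Rightarrow> torus_pt) \<Rightarrow> (torus_pt \<Rightarrow> torus_pt) \<Rightarrow> bool" where
  "isotopic \<equiv> isotopic_rel {}"


section \<open>Shear type and standard axes\<close>

text \<open>\<open>A\<close> parametrizes a closed annulus with core curve \<open>c\<close>. Replacing \<open>A (z, t)\<close> by
  \<open>A (z, 1 - t)\<close> inverts the twist, so twists of both signs are covered.\<close>

definition dehn_twist_along :: "(real \<Rightarrow> torus_pt) \<Rightarrow> (torus_pt \<Rightarrow> torus_pt) \<Rightarrow> bool" where
  "dehn_twist_along c \<tau> \<longleftrightarrow>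
     (\<exists>A :: complex \<times> real \<Rightarrow> torus_pt.
        continuous_on (sphere 0 1 \<times> {0..1}) A \<and>
        inj_on A (sphere 0 1 \<times> {0..1}) \<and>
        A ` (sphere 0 1 \<times> {0..1}) \<subseteq> torus \<and>
        (\<forall>s\<in>{0..1}. c s = A (cis (2 * pi * s), 1/2)) \<and>
        (\<forall>z\<in>sphere 0 1. \<forall>t\<in>{0..1}. \<tau> (A (z, t)) = A (z * cis (2 * pi * t), t)) \<and>
        (\<forall>p\<in>torus - A ` (sphere 0 1 \<times> {0..1}). \<tau> p = p))"

text \<open>The curve has to be essential: a twist along a contractible curve is isotopic to the identity.\<close>

definition shear_type :: "(torus_pt \<Rightarrow> torus_pt) \<Rightarrow> bool" where
  "shear_type f \<longleftrightarrow>
     (\<exists>c \<tau>. (\<nexists>p. homotopic_loops torus c (\<lambda>_. p)) \<and> dehn_twist_along c \<tau> \<and> isotopic f \<tau>)"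

text \<open>\<open>H\<^sub>1\<close> of the torus is identified with the lattice of integer vectors in the universal cover. The
  class \<open>a\<close> is represented by \<open>straight_loop a\<close>; on the torus two loops are homologous iff they
  are freely homotopic.\<close>

definition lattice_vec :: "int \<times> int \<Rightarrow> real \<times> real" where
  "lattice_vec a = (of_int (fst a), of_int (snd a))"

definition straight_loop :: "int \<times> int \<Rightarrow> real \<Rightarrow> torus_pt" where
  "straight_loop a t = torus_cover (t *\<^sub>R lattice_vec a)"

definition has_class :: "(real \<Rightarrow> torus_pt) \<Rightarrow> int \<times> int \<Rightarrow> bool" where
  "has_class \<gamma> a \<longleftrightarrow> homotopic_loops torus \<gamma> (straight_loop a)"

text \<open>\<open>a\<close> is the horizontal and \<open>b\<close> the vertical class.\<close>

definition standard_axes :: "int \<times> int \<Rightarrow> int \<times> int \<Rightarrow> (torus_pt \<Rightarrow> torus_pt) \<Rightarrow> bool" where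
  "standard_axes a b f \<longleftrightarrow>
     \<bar>fst a * snd b - snd a * fst b\<bar> = 1 \<and>
     has_class (f \<circ> straight_loop a) (a + b) \<and>
     has_class (f \<circ> straight_loop b) b"


section \<open>Periodic orbits and rotation number\<close>

definition periodic_orbit :: "(torus_pt \<Rightarrow> torus_pt) \<Rightarrow> torus_pt set \<Rightarrow> bool" where
  "periodic_orbit f x \<longleftrightarrow>
     (\<exists>z\<in>torus. \<exists>p>0. (f ^^ p) z = z \<and> x = (\<lambda>j. (f ^^ j) z) ` {..<p})"

definition is_lift :: "(torus_pt \<Rightarrow> torus_pt) \<Rightarrow> (real \<times> real \<Rightarrow> real \<times> real) \<Rightarrow> bool" where
  "is_lift f F \<longleftrightarrow> continuous_on UNIV F \<and> (\<forall>v. torus_cover (F v) = f (torus_cover v))"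

text \<open>The period of an orbit \<open>x\<close> is \<open>card x\<close>. The value is well defined whenever \<open>a\<close>, \<open>b\<close> are
  standard axes for \<open>f\<close> and \<open>x\<close> is a periodic orbit of \<open>f\<close>.\<close>

definition rotation_number ::
    "int \<times> int \<Rightarrow> int \<times> int \<Rightarrow> (torus_pt \<Rightarrow> torus_pt) \<Rightarrow> torus_pt set \<Rightarrow> real" where
  "rotation_number a b f x =
     (THE r. \<exists>F v q m. is_lift f F \<and> torus_cover v \<in> x \<and>
        (F ^^ card x) v = v + of_int q *\<^sub>R lattice_vec a + of_int m *\<^sub>R lattice_vec b \<and>
        r = frac (of_int q / of_nat (card x)))"


section \<open>Similarity, forcing, twist type\<close>

definition similar_orbits ::
    "torus_pt set \<Rightarrow> (torus_pt \<Rightarrow> torus_pt) \<Rightarrow> torus_pt set \<Rightarrow> (torus_pt \<Rightarrow> torus_pt) \<Rightarrow> bool" where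
  "similar_orbits x f y g \<longleftrightarrow>
     (\<exists>h h'. homeomorphism torus torus h h' \<and> isotopic id h \<and> h ` x = y \<and>
        isotopic_rel y (h \<circ> f \<circ> h') g)"

definition forces ::
    "torus_pt set \<Rightarrow> (torus_pt \<Rightarrow> torus_pt) \<Rightarrow> torus_pt set \<Rightarrow> (torus_pt \<Rightarrow> torus_pt) \<Rightarrow> bool" where
  "forces x f y g \<longleftrightarrow>
     (\<forall>f'. isotopic_rel x f f' \<longrightarrow> (\<exists>y'. periodic_orbit f' y' \<and> similar_orbits y' f' y g))"

text \<open>Every \<open>g\<close> whose orbit is forced by an orbit of \<open>f\<close> is isotopic to \<open>f\<close>, so it is of shear type
  with the same standard axes; these two premises only ensure that the rotation number is defined.\<close>

definition twist_type ::
    "int \<times> int \<Rightarrow> int \<times> int \<Rightarrow> torus_pt set \<Rightarrow> (torus_pt \<Rightarrow> torus_pt) \<Rightarrow> bool" where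
  "twist_type a b x f \<longleftrightarrow>
     (\<forall>y g. shear_type g \<and> standard_axes a b g \<and> periodic_orbit g y \<and>
        rotation_number a b g y = rotation_number a b f x \<and> forces x f y g \<longrightarrow>
        similar_orbits y g x f)"


section \<open>Simple orbits\<close>

text \<open>The circle is \<open>S\<^sup>1 \<times> {1}\<close>, and the \<open>j\<close>-th attached loop is \<open>{\<omega>\<^sup>j} \<times> S\<^sup>1\<close>.\<close>

definition root_pt :: "nat \<Rightarrow> nat \<Rightarrow> complex" where
  "root_pt N j = cis (2 * pi * of_nat j / of_nat N)"

definition loop_graph :: "nat \<Rightarrow> (complex \<times> complex) set" where
  "loop_graph N = sphere 0 1 \<times> {1} \<union> root_pt N ` {..<N} \<times> sphere 0 1"

text \<open>Precomposing with symmetries of the graph, the loops may be assumed to be parametrized in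
  the positive direction; the attached loops are then numbered forwards. Injectivity makes the
  vertical loops pairwise disjoint and makes each meet the horizontal loop in one point.\<close>

definition axis_embedding ::
    "int \<times> int \<Rightarrow> int \<times> int \<Rightarrow> nat \<Rightarrow> (complex \<times> complex \<Rightarrow> torus_pt) \<Rightarrow> bool" where
  "axis_embedding a b N \<iota> \<longleftrightarrow>
     continuous_on (loop_graph N) \<iota> \<and> inj_on \<iota> (loop_graph N) \<and> \<iota> ` loop_graph N \<subseteq> torus \<and>
     has_class (\<lambda>s. \<iota> (cis (2 * pi * s), 1)) a \<and>
     (\<forall>j<N. has_class (\<lambda>s. \<iota> (root_pt N j, cis (2 * pi * s))) b) \<and>
     card (components (torus - \<iota> ` loop_graph N)) = N \<and>
     (\<forall>R\<in>components (torus - \<iota> ` loop_graph N).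
        R homeomorphic ({0<..<1} \<times> {0<..<1} :: (real \<times> real) set))"

definition deformation_retraction ::
    "'a::topological_space set \<Rightarrow> 'a set \<Rightarrow> ('a \<Rightarrow> 'a) \<Rightarrow> bool" where
  "deformation_retraction S A r \<longleftrightarrow>
     retraction S A r \<and> homotopic_with_canon (\<lambda>_. True) S S id r"

text \<open>The \<open>j\<close>-th attached loop goes to the loop \<open>k\<close> places forwards; the circle is rotated by \<open>k\<close>
  places, except that the image of the edge starting at \<open>root_pt N m\<close> first runs once around the
  attached loop at its initial point. For standard axes the twist can only be in the positive
  vertical direction.\<close>

definition simple_graph_map ::
    "nat \<Rightarrow> nat \<Rightarrow> nat \<Rightarrow> (complex \<times> complex \<Rightarrow> complex \<times> complex) \<Rightarrow> bool" where
  "simple_graph_map N k m M \<longleftrightarrow>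
     (\<forall>j<N. \<forall>w\<in>sphere 0 1. M (root_pt N j, w) = (root_pt N (j + k), w)) \<and>
     (\<forall>s\<in>{0..1} - {of_nat m / of_nat N .. of_nat (m + 1) / of_nat N}.
        M (cis (2 * pi * s), 1) = (root_pt N k * cis (2 * pi * s), 1)) \<and>
     (\<forall>u\<in>{0..1}. M (root_pt N m * cis (2 * pi * u / of_nat N), 1) =
        (if u \<le> 1/2 then (root_pt N (m + k), cis (2 * pi * (2 * u)))
         else (root_pt N (m + k) * cis (2 * pi * (2 * u - 1) / of_nat N), 1)))"

text \<open>The action induced on the graph is the composition of \<open>f'\<close> with a deformation retraction \<open>r\<close>
  of the invariant neighborhood \<open>U\<close>. It is well defined up to homotopy, independently of \<open>r\<close>.\<close>

definition simple_orbit ::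
    "int \<times> int \<Rightarrow> int \<times> int \<Rightarrow> torus_pt set \<Rightarrow> (torus_pt \<Rightarrow> torus_pt) \<Rightarrow> bool" where
  "simple_orbit a b x f \<longleftrightarrow>
     (let N = card x in
      \<exists>\<iota>. axis_embedding a b N \<iota> \<and>
        (\<exists>r. deformation_retraction (torus - x) (\<iota> ` loop_graph N) r) \<and>
        (\<exists>f' U V r. isotopic_rel x f f' \<and>
           openin (top_of_set torus) V \<and> \<iota> ` loop_graph N \<subseteq> V \<and> V \<subseteq> U \<and> U \<subseteq> torus - x \<and>
           f' ` U = U \<and> deformation_retraction U (\<iota> ` loop_graph N) r \<and>
           (\<exists>k<N. \<exists>m<N. \<exists>M. simple_graph_map N k m M \<and>
              homotopic_with_canon (\<lambda>_. True) (loop_graph N) (\<iota> ` loop_graph N)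
                (r \<circ> f' \<circ> \<iota>) (\<iota> \<circ> M))))"

end

theory Submission
  imports Defs "HOL-Complex_Analysis.Riemann_Mapping"
begin

text \<open>The example is \<open>f(z, w) = (g z, \<mu> z * w)\<close>, where \<open>g\<close> is a parabolic circle map with fixed point
  \<open>-1\<close> and \<open>\<mu>\<close> is a circle map of degree one with \<open>\<mu>(-1) = -1\<close>. All periodic points of \<open>f\<close> lie on the
  circle \<open>z = -1\<close>, where \<open>f\<close> is the rotation by one half. The periodic orbits are therefore the
  vertical translates of \<open>{(-1, 1), (-1, -1)}\<close>. Vertical translations commute with \<open>f\<close>, so all these
  orbits are similar and each of them is of twist type.

  The orbit has period 2 and rotation number 0, which no simple orbit has. Homologically: vertical
  loops in the complement of the orbit are classified by an integer \<open>D\<close>, and \<open>f\<close> changes the sign of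
  \<open>D\<close>, as it exchanges the two points while it moves some vertical loop to a homotopic one. If the
  orbit were simple, then \<open>f\<close> would permute the two vertical loops of the graph, and so their \<open>D\<close> would
  have the same parity. But the graph is a deformation retract of the complement, which forces these
  parities to differ: otherwise a function on the complement with odd index at a point of the orbit
  would have even winding numbers along all the loops of the graph, hence a square root.\<close>

section \<open>Winding numbers about the origin\<close>

definition punctured_loop :: "(real \<Rightarrow> complex) \<Rightarrow> bool" where
  "punctured_loop p \<longleftrightarrow> path p \<and> pathfinish p = pathstart p \<and> 0 \<notin> path_image p"

lemma punctured_loop_iff:
  "punctured_loop p \<longleftrightarrow> continuous_on {0..1} p \<and> p 1 = p 0 \<and> (\<forall>t\<in>{0..1}. p t \<noteq> 0)"
  by (auto simp: punctured_loop_def path_def pathfinish_def pathstart_def path_image_def)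

text \<open>Winding numbers become increments of a logarithm. Together with its converse
  \<open>punctured_loop_log\<close> this reduces the calculus below to arithmetic of
  increments.\<close>

lemma winding_number_exp_path:
  assumes "path q" and "\<And>t. t \<in> {0..1} \<Longrightarrow> p t = exp (q t)"
  shows "winding_number p 0 = (q 1 - q 0) / (2 * of_real pi * \<i>)"
proof -
  have "winding_number p 0 = winding_number (exp \<circ> q) 0"
    by (rule winding_number_cong) (use assms in auto)
  then show ?thesis
    using winding_number_compose_exp [OF assms(1)] by (simp add: pathfinish_def pathstart_def)
qed

lemma punctured_loop_log:
  assumes "punctured_loop p"
  obtains q where "path q" "q 1 - q 0 = 2 * of_real pi * \<i> * winding_number p 0"
    "\<And>t. t \<in> {0..1} \<Longrightarrow> p t = exp (q t)"
proof -
  have "path p" "0 \<notin> path_image p"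
    using assms by (auto simp: punctured_loop_def)
  then obtain q where "path q" "pathfinish q - pathstart q = 2 * of_real pi * \<i> * winding_number p 0"
    "\<And>t. t \<in> {0..1} \<Longrightarrow> p t = 0 + exp (q t)"
    using winding_number_as_continuous_log by blast
  with that show ?thesis
    by (simp add: pathfinish_def pathstart_def)
qed

lemma punctured_loop_mult:
  "punctured_loop p \<Longrightarrow> punctured_loop q \<Longrightarrow> punctured_loop (\<lambda>t. p t * q t)"
  by (auto simp: punctured_loop_iff intro: continuous_intros)

lemma winding_number_mult:
  assumes "punctured_loop p" "punctured_loop q"
  shows "winding_number (\<lambda>t. p t * q t) 0 = winding_number p 0 + winding_number q 0"
proof -
  obtain P where P: "path P" "P 1 - P 0 = 2 * of_real pi * \<i> * winding_number p 0"
    "\<And>t. t \<in> {0..1} \<Longrightarrow> p t = exp (P t)"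
    using punctured_loop_log [OF assms(1)] by blast
  obtain Q where Q: "path Q" "Q 1 - Q 0 = 2 * of_real pi * \<i> * winding_number q 0"
    "\<And>t. t \<in> {0..1} \<Longrightarrow> q t = exp (Q t)"
    using punctured_loop_log [OF assms(2)] by blast
  have "path (\<lambda>t. P t + Q t)"
    using P(1) Q(1) by (auto simp: path_def intro: continuous_intros)
  then have "winding_number (\<lambda>t. p t * q t) 0 = ((P 1 + Q 1) - (P 0 + Q 0)) / (2 * of_real pi * \<i>)"
    by (rule winding_number_exp_path) (simp add: P Q exp_add)
  also have "(P 1 + Q 1) - (P 0 + Q 0) = (P 1 - P 0) + (Q 1 - Q 0)"
    by simp
  finally show ?thesis
    unfolding P(2) Q(2) by (simp flip: distrib_left)
qed

lemma winding_number_const_loop: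
  assumes "c \<noteq> 0"
  shows "punctured_loop (\<lambda>_. c)" "winding_number (\<lambda>_. c) 0 = 0"
proof -
  show "punctured_loop (\<lambda>_. c)"
    using assms by (simp add: punctured_loop_iff)
  have "winding_number (\<lambda>_. c) 0 = (Ln c - Ln c) / (2 * of_real pi * \<i>)"
    by (rule winding_number_exp_path) (use assms in \<open>auto simp: path_def\<close>)
  then show "winding_number (\<lambda>_. c) 0 = 0"
    by simp
qed

lemma winding_number_power:
  assumes "punctured_loop p"
  shows "punctured_loop (\<lambda>t. p t ^ n) \<and> winding_number (\<lambda>t. p t ^ n) 0 = of_nat n * winding_number p 0"
proof (induction n)
  case 0
  show ?case
    using winding_number_const_loop [of 1] by simp
next
  case (Suc n)
  then show ?case
    using punctured_loop_mult [OF assms, of "\<lambda>t. p t ^ n"] winding_number_mult [OF assms, of "\<lambda>t. p t ^ n"]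
    by (simp add: algebra_simps)
qed

lemma punctured_loop_winding_number_int:
  assumes "punctured_loop p"
  obtains n :: int where "winding_number p 0 = of_int n"
  using assms integer_winding_number unfolding punctured_loop_def by (metis Ints_cases)

lemma winding_number_cnj_loop:
  assumes "punctured_loop p"
  shows "punctured_loop (\<lambda>t. cnj (p t)) \<and> winding_number (\<lambda>t. cnj (p t)) 0 = - winding_number p 0"
proof -
  obtain n :: int where n: "winding_number p 0 = of_int n"
    using punctured_loop_winding_number_int [OF assms] .
  \<comment> \<open>The conjugate on the right is harmless, as the winding number of a loop is an
    integer.\<close>
  have "winding_number (cnj \<circ> p) (cnj 0) = - cnj (winding_number p 0)"
    by (rule winding_number_cnj) (use assms in \<open>auto simp: punctured_loop_def\<close>)
  then show ?thesis
    using assms n by (auto simp: punctured_loop_iff o_def intro: continuous_intros)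
qed

text \<open>The principal logarithm is continuous along such a loop and takes the same value at both
  ends.\<close>

lemma winding_number_slit_plane:
  assumes "punctured_loop p" "\<And>t. t \<in> {0..1} \<Longrightarrow> p t \<notin> \<real>\<^sub>\<le>\<^sub>0"
  shows "winding_number p 0 = 0"
proof -
  have "path (\<lambda>t. Ln (p t))"
    using assms unfolding path_def punctured_loop_iff
    by (intro continuous_on_Ln') auto
  then have "winding_number p 0 = (Ln (p 1) - Ln (p 0)) / (2 * of_real pi * \<i>)"
    by (rule winding_number_exp_path) (use assms in \<open>auto simp: punctured_loop_iff\<close>)
  then show ?thesis
    using assms(1) by (simp add: punctured_loop_iff)
qed

lemma winding_number_cis:
  fixes n :: int
  shows "punctured_loop (\<lambda>t. cis (2 * pi * (t * of_int n))) \<and>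
         winding_number (\<lambda>t. cis (2 * pi * (t * of_int n))) 0 = of_int n"
proof
  show "punctured_loop (\<lambda>t. cis (2 * pi * (t * of_int n)))"
    by (auto simp: punctured_loop_iff intro!: continuous_intros)
  have "path (\<lambda>t. \<i> * of_real (2 * pi * (t * of_int n)))"
    unfolding path_def by (intro continuous_intros)
  then have "winding_number (\<lambda>t. cis (2 * pi * (t * of_int n))) 0
      = (\<i> * of_real (2 * pi * (1 * of_int n)) - \<i> * of_real (2 * pi * (0 * of_int n)))
        / (2 * of_real pi * \<i>)"
    by (rule winding_number_exp_path) (simp add: cis_conv_exp)
  then show "winding_number (\<lambda>t. cis (2 * pi * (t * of_int n))) 0 = of_int n"
    by simp
qed

lemma punctured_loop_compose:
  assumes "path \<gamma>" "pathfinish \<gamma> = pathstart \<gamma>" "path_image \<gamma> \<subseteq> S"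
    and "continuous_on S \<psi>" "\<And>p. p \<in> S \<Longrightarrow> \<psi> p \<noteq> 0"
  shows "punctured_loop (\<lambda>t. \<psi> (\<gamma> t))"
proof -
  have "path (\<psi> \<circ> \<gamma>)"
    using assms by (meson continuous_on_subset path_continuous_image)
  with assms show ?thesis
    by (auto simp: punctured_loop_iff path_def o_def pathfinish_def pathstart_def path_image_def)
qed

text \<open>Each continuous nowhere zero function on \<open>S\<close> gives an integer invariant of
  free homotopy classes of loops in \<open>S\<close>. The invariants used below come from functions
  built from the coordinates and \<open>marking\<close>.\<close>

lemma winding_number_homotopic_compose:
  assumes "homotopic_loops S \<gamma> \<gamma>'" "continuous_on S \<psi>" "\<And>p. p \<in> S \<Longrightarrow> \<psi> p \<noteq> 0"
  shows "winding_number (\<lambda>t. \<psi> (\<gamma> t)) 0 = winding_number (\<lambda>t. \<psi> (\<gamma>' t)) 0"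
proof -
  have "homotopic_loops (-{0}) (\<psi> \<circ> \<gamma>) (\<psi> \<circ> \<gamma>')"
    using assms by (intro homotopic_loops_continuous_image) auto
  then show ?thesis
    using winding_number_homotopic_loops by (fastforce simp: o_def)
qed

lemma homotopic_loops_compose:
  assumes "homotopic_with_canon (\<lambda>_. True) S T F G"
    and "path \<gamma>" "pathfinish \<gamma> = pathstart \<gamma>" "path_image \<gamma> \<subseteq> S"
  shows "homotopic_loops T (F \<circ> \<gamma>) (G \<circ> \<gamma>)"
  unfolding homotopic_loops_def
proof (rule homotopic_with_compose_continuous_map_right [OF assms(1)])
  show "continuous_map (top_of_set {0..1}) (top_of_set S) \<gamma>"
    using assms by (auto simp: path_def path_image_def)
qed (use assms in \<open>auto simp: pathfinish_def pathstart_def\<close>)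

section \<open>Square roots on circles with attached loops\<close>

text \<open>Dividing by \<open>z powi (2 * n)\<close> removes the winding, so a continuous logarithm
  exists on the circle; half of it, with \<open>z powi n\<close> put back, gives the root.\<close>

lemma circle_map_sqrt:
  assumes cont: "continuous_on (sphere 0 1) g" and nz: "\<And>z. z \<in> sphere 0 1 \<Longrightarrow> g z \<noteq> 0"
    and even: "winding_number (\<lambda>t. g (cis (2 * pi * t))) 0 = 2 * of_int n"
  obtains h where "continuous_on (sphere 0 1) h" "\<And>z. z \<in> sphere 0 1 \<Longrightarrow> h z ^ 2 = g z"
proof -
  let ?p = "\<lambda>t. g (cis (2 * pi * t)) * cis (2 * pi * (t * of_int (- 2 * n)))"
  have g: "punctured_loop (\<lambda>t. g (cis (2 * pi * t)))"
  proof (rule punctured_loop_compose [where S = "sphere 0 1" and \<gamma> = "\<lambda>t. cis (2 * pi * t)"])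
    show "path (\<lambda>t. cis (2 * pi * t))"
      unfolding path_def by (intro continuous_intros)
  qed (use cont nz in \<open>auto simp: pathfinish_def pathstart_def path_image_def\<close>)
  note c = winding_number_cis [of "- 2 * n"]
  have p: "punctured_loop ?p"
    by (rule punctured_loop_mult [OF g]) (use c in blast)
  have "winding_number ?p 0 = 2 * of_int n + of_int (- 2 * n)"
    using winding_number_mult [OF g] c even by metis
  then have "winding_number ?p 0 = 0"
    by simp
  then obtain a where "homotopic_loops (-{0}) ?p (\<lambda>t. a)"
    using winding_number_homotopic_loops_null_eq [of ?p 0] p unfolding punctured_loop_def by blast
  \<comment> \<open>The existence of a logarithm is stated for maps on the circle, so the loop is
    rewritten as such a map through \<open>Arg2pi\<close>.\<close>
  then have "homotopic_with_canon (\<lambda>h. True) (sphere 0 1) (-{0})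
       (?p \<circ> (\<lambda>z. Arg2pi z / (2 * pi))) ((\<lambda>t. a) \<circ> (\<lambda>z. Arg2pi z / (2 * pi)))"
    by (rule homotopic_loops_imp_homotopic_circlemaps)
  then have "\<exists>a. homotopic_with_canon (\<lambda>h. True) (sphere 0 1) (-{0})
       (?p \<circ> (\<lambda>z. Arg2pi z / (2 * pi))) (\<lambda>t. a)"
    by (auto simp: o_def)
  then obtain l where l: "continuous_on (sphere 0 1) l"
    "\<And>z. z \<in> sphere 0 1 \<Longrightarrow> (?p \<circ> (\<lambda>z. Arg2pi z / (2 * pi))) z = exp (l z)"
    unfolding inessential_eq_continuous_logarithm by blast
  define h where "h = (\<lambda>z. z powi n * exp (l z / 2))"
  show thesis
  proof
    show "continuous_on (sphere 0 1) h"
      unfolding h_def by (intro continuous_intros l) auto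
    fix z :: complex
    assume z: "z \<in> sphere 0 1"
    have cz: "cis (Arg2pi z) = z"
      using z Arg2pi_eq [of z] by (simp add: cis_conv_exp)
    have "cis (Arg2pi z * of_int (- 2 * n)) = cis (Arg2pi z) powi (- 2 * n)"
      by (simp add: cis_power_int mult.commute)
    then have "exp (l z) = g z * z powi (- 2 * n)"
      using l(2) [OF z] cz by (simp add: ac_simps)
    moreover have "h z ^ 2 = z powi (2 * n) * exp (l z)"
    proof -
      have "exp (l z / 2) ^ 2 = exp (l z)"
        by (simp add: power2_eq_square flip: exp_add)
      moreover have "(z powi n) ^ 2 = z powi (2 * n)"
        using power_int_mult [of z n 2] by (simp add: mult.commute)
      ultimately show ?thesis
        by (simp add: h_def power_mult_distrib)
    qed
    moreover have "z powi (2 * n) * z powi (- 2 * n) = 1"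
      using z by (subst power_int_add [symmetric]) auto
    ultimately show "h z ^ 2 = g z"
      by (metis mult.assoc mult.commute mult_1)
  qed
qed

text \<open>Roots are chosen separately on the circle and on each attached loop. At the attaching
  point \<open>(z, 1)\<close> both are roots of the same number, so they differ by a sign, which the
  factor \<open>h z / v z 1\<close> corrects.\<close>

lemma loops_on_circle_sqrt:
  fixes Z :: "complex set"
  defines "K \<equiv> sphere 0 1 \<times> {1} \<union> Z \<times> sphere 0 1"
  assumes "finite Z" "Z \<subseteq> sphere 0 1"
    and cont: "continuous_on K \<psi>" and nz: "\<And>p. p \<in> K \<Longrightarrow> \<psi> p \<noteq> 0"
    and circle: "winding_number (\<lambda>t. \<psi> (cis (2 * pi * t), 1)) 0 = 2 * of_int n"
    and loops: "\<And>z. z \<in> Z \<Longrightarrow> winding_number (\<lambda>t. \<psi> (z, cis (2 * pi * t))) 0 = 2 * of_int (m z)"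
  obtains \<sigma> where "continuous_on K \<sigma>" "\<And>p. p \<in> K \<Longrightarrow> \<sigma> p ^ 2 = \<psi> p"
proof -
  have "continuous_on (sphere 0 1) (\<lambda>z. \<psi> (z, 1))"
    by (rule continuous_on_compose2 [OF cont]) (auto simp: K_def intro!: continuous_intros)
  then obtain h where h: "continuous_on (sphere 0 1) h" "\<And>z. z \<in> sphere 0 1 \<Longrightarrow> h z ^ 2 = \<psi> (z, 1)"
    using circle_map_sqrt [of "\<lambda>z. \<psi> (z, 1)", OF _ _ circle] nz unfolding K_def by auto
  have "\<exists>v. continuous_on (sphere 0 1) v \<and> (\<forall>w\<in>sphere 0 1. v w ^ 2 = \<psi> (z, w))" if z: "z \<in> Z" for z
  proof -
    have "continuous_on (sphere 0 1) (\<lambda>w. \<psi> (z, w))"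
      by (rule continuous_on_compose2 [OF cont]) (auto simp: K_def z intro!: continuous_intros)
    then show ?thesis
      using circle_map_sqrt [of "\<lambda>w. \<psi> (z, w)", OF _ _ loops [OF z]] nz z unfolding K_def
      by (metis (no_types, lifting) SigmaI UnI2)
  qed
  then obtain v where v: "\<And>z. z \<in> Z \<Longrightarrow> continuous_on (sphere 0 1) (v z)"
    "\<And>z w. z \<in> Z \<Longrightarrow> w \<in> sphere 0 1 \<Longrightarrow> v z w ^ 2 = \<psi> (z, w)"
    by metis
  have v1: "v z 1 \<noteq> 0" if "z \<in> Z" for z
    using v(2) [of z 1] nz [of "(z, 1)"] that by (auto simp: K_def)
  define \<sigma> where "\<sigma> = (\<lambda>(z, w). if w = 1 then h z else h z / v z 1 * v z w)"
  have \<sigma>1: "\<sigma> (z, w) = h z / v z 1 * v z w" if "z \<in> Z" for z w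
    using v1 [OF that] by (simp add: \<sigma>_def)
  show thesis
  proof
    have "continuous_on ({z} \<times> sphere 0 1) \<sigma>" if "z \<in> Z" for z
    proof (rule continuous_on_eq)
      show "continuous_on ({z} \<times> sphere 0 1) (\<lambda>p. h z / v z 1 * v z (snd p))"
        using that v1 [OF that]
        by (intro continuous_intros continuous_on_compose2 [OF v(1)]) auto
      show "h z / v z 1 * v z (snd p) = \<sigma> p" if "p \<in> {z} \<times> sphere 0 1" for p
        using that \<open>z \<in> Z\<close> \<sigma>1 by auto
    qed
    then have "continuous_on (\<Union>z\<in>Z. {z} \<times> sphere 0 1) \<sigma>"
      using \<open>finite Z\<close> by (intro continuous_on_closed_Union) (auto simp: closed_Times)
    moreover have "(\<Union>z\<in>Z. {z} \<times> sphere 0 1) = Z \<times> sphere (0::complex) 1"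
      by auto
    moreover have "continuous_on (sphere 0 1 \<times> {1}) \<sigma>"
    proof (rule continuous_on_eq)
      show "continuous_on (sphere 0 1 \<times> {1}) (\<lambda>p. h (fst p))"
        by (intro continuous_intros continuous_on_compose2 [OF h(1)]) auto
    qed (auto simp: \<sigma>_def)
    ultimately show "continuous_on K \<sigma>"
      unfolding K_def using \<open>finite Z\<close>
      by (intro continuous_on_closed_Un) (auto simp: closed_Times finite_imp_closed)
    show "\<sigma> p ^ 2 = \<psi> p" if p: "p \<in> K" for p
    proof (cases "snd p = 1")
      case True
      then show ?thesis
        using p h(2) \<open>Z \<subseteq> sphere 0 1\<close> by (auto simp: K_def \<sigma>_def split: prod.splits)
    next
      case False
      then have z: "fst p \<in> Z" "snd p \<in> sphere 0 1"
        using p by (auto simp: K_def)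
      then have "h (fst p) ^ 2 = v (fst p) 1 ^ 2"
        using h(2) v(2) \<open>Z \<subseteq> sphere 0 1\<close> by auto
      then show ?thesis
        using \<sigma>1 [OF z(1), of "snd p"] v(2) [OF z] v1 [OF z(1)]
        by (simp add: power_mult_distrib power_divide)
    qed
  qed
qed


section \<open>Homology classes of loops in the torus\<close>

lemma mem_torus: "p \<in> torus \<longleftrightarrow> norm (fst p) = 1 \<and> norm (snd p) = 1"
  by (cases p) (auto simp: torus_def)

lemma has_class_winding_numbers:
  assumes "has_class \<gamma> a"
  shows "punctured_loop (\<lambda>t. fst (\<gamma> t))" "punctured_loop (\<lambda>t. snd (\<gamma> t))"
    "winding_number (\<lambda>t. fst (\<gamma> t)) 0 = of_int (fst a)"
    "winding_number (\<lambda>t. snd (\<gamma> t)) 0 = of_int (snd a)"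
proof -
  have h: "homotopic_loops torus \<gamma> (straight_loop a)"
    using assms by (simp add: has_class_def)
  have nz: "fst p \<noteq> 0" "snd p \<noteq> 0" if "p \<in> torus" for p
    using that by (auto simp: mem_torus)
  have cont: "continuous_on torus fst" "continuous_on torus snd"
    by (intro continuous_intros)+
  show "punctured_loop (\<lambda>t. fst (\<gamma> t))" "punctured_loop (\<lambda>t. snd (\<gamma> t))"
    using h homotopic_loops_imp_path homotopic_loops_imp_loop homotopic_loops_imp_subset cont nz
    by (metis punctured_loop_compose)+
  have "(\<lambda>t. fst (straight_loop a t)) = (\<lambda>t. cis (2 * pi * (t * of_int (fst a))))"
    "(\<lambda>t. snd (straight_loop a t)) = (\<lambda>t. cis (2 * pi * (t * of_int (snd a))))"
    by (simp_all add: straight_loop_def torus_cover_def lattice_vec_def)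
  then show "winding_number (\<lambda>t. fst (\<gamma> t)) 0 = of_int (fst a)"
    "winding_number (\<lambda>t. snd (\<gamma> t)) 0 = of_int (snd a)"
    using winding_number_homotopic_compose [OF h cont(1)] winding_number_homotopic_compose [OF h cont(2)]
      nz winding_number_cis by simp_all
qed

text \<open>Equal winding numbers give a homotopy in the punctured plane, and the radial projection
  \<open>sgn\<close> moves it into the circle.\<close>

lemma homotopic_loops_unit_circle:
  assumes p: "punctured_loop p" "\<And>t. t \<in> {0..1} \<Longrightarrow> norm (p t) = 1"
    and q: "punctured_loop q" "\<And>t. t \<in> {0..1} \<Longrightarrow> norm (q t) = 1"
    and "winding_number p 0 = winding_number q 0"
  shows "homotopic_loops (sphere 0 1) p q"
proof -
  have "homotopic_loops (-{0}) p q"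
    using assms winding_number_homotopic_loops_eq unfolding punctured_loop_def by blast
  then have "homotopic_loops (sphere 0 1) (sgn \<circ> p) (sgn \<circ> q)"
    by (rule homotopic_loops_continuous_image) (auto intro!: continuous_intros simp: norm_sgn)
  moreover have "homotopic_loops (sphere 0 1) p (sgn \<circ> p)" "homotopic_loops (sphere 0 1) q (sgn \<circ> q)"
    using p q by (auto intro!: homotopic_loops_eq simp: punctured_loop_def path_image_def sgn_eq)
  ultimately show ?thesis
    using homotopic_loops_sym homotopic_loops_trans by metis
qed

text \<open>The torus is a product, so the two coordinates can be deformed independently. This
  reduces the computation of classes to that of two winding numbers.\<close>

lemma has_class_iff:
  "has_class \<gamma> a \<longleftrightarrow> path \<gamma> \<and> path_image \<gamma> \<subseteq> torus \<and> pathfinish \<gamma> = pathstart \<gamma> \<and>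
     winding_number (\<lambda>t. fst (\<gamma> t)) 0 = of_int (fst a) \<and>
     winding_number (\<lambda>t. snd (\<gamma> t)) 0 = of_int (snd a)"
proof
  assume "has_class \<gamma> a"
  then show "path \<gamma> \<and> path_image \<gamma> \<subseteq> torus \<and> pathfinish \<gamma> = pathstart \<gamma> \<and>
     winding_number (\<lambda>t. fst (\<gamma> t)) 0 = of_int (fst a) \<and>
     winding_number (\<lambda>t. snd (\<gamma> t)) 0 = of_int (snd a)"
    using has_class_winding_numbers homotopic_loops_imp_path homotopic_loops_imp_loop
      homotopic_loops_imp_subset unfolding has_class_def by blast
next
  assume \<gamma>: "path \<gamma> \<and> path_image \<gamma> \<subseteq> torus \<and> pathfinish \<gamma> = pathstart \<gamma> \<and>
     winding_number (\<lambda>t. fst (\<gamma> t)) 0 = of_int (fst a) \<and>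
     winding_number (\<lambda>t. snd (\<gamma> t)) 0 = of_int (snd a)"
  have \<gamma>t: "norm (fst (\<gamma> t)) = 1" "norm (snd (\<gamma> t)) = 1" if "t \<in> {0..1}" for t
    using \<gamma> that unfolding path_image_def by (metis image_subset_iff mem_torus)+
  have loops: "punctured_loop (\<lambda>t. fst (\<gamma> t))" "punctured_loop (\<lambda>t. snd (\<gamma> t))"
    by (rule punctured_loop_compose [where S = torus];
        use \<gamma> in \<open>auto simp: mem_torus intro: continuous_intros\<close>)+
  have "homotopic_loops (sphere 0 1) (\<lambda>t. fst (\<gamma> t)) (\<lambda>t. cis (2 * pi * (t * of_int (fst a))))"
    "homotopic_loops (sphere 0 1) (\<lambda>t. snd (\<gamma> t)) (\<lambda>t. cis (2 * pi * (t * of_int (snd a))))"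
    by (rule homotopic_loops_unit_circle; use \<gamma> \<gamma>t loops winding_number_cis in auto)+
  then obtain h k where
    h: "continuous_on ({0..1} \<times> {0..1}) h" "h \<in> {0..1} \<times> {0..1} \<rightarrow> sphere 0 1"
      "\<forall>x\<in>{0..1}. h (0, x) = fst (\<gamma> x)" "\<forall>x\<in>{0..1}. h (1, x) = cis (2 * pi * (x * of_int (fst a)))"
      "\<forall>t\<in>{0..1::real}. pathfinish (h \<circ> Pair t) = pathstart (h \<circ> Pair t)" and
    k: "continuous_on ({0..1} \<times> {0..1}) k" "k \<in> {0..1} \<times> {0..1} \<rightarrow> sphere 0 1"
      "\<forall>x\<in>{0..1}. k (0, x) = snd (\<gamma> x)" "\<forall>x\<in>{0..1}. k (1, x) = cis (2 * pi * (x * of_int (snd a)))"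
      "\<forall>t\<in>{0..1::real}. pathfinish (k \<circ> Pair t) = pathstart (k \<circ> Pair t)"
    unfolding homotopic_loops by auto
  show "has_class \<gamma> a"
    unfolding has_class_def homotopic_loops
  proof (intro exI [where x = "\<lambda>q. (h q, k q)"] conjI)
    show "continuous_on ({0..1} \<times> {0..1}) (\<lambda>q. (h q, k q))"
      by (intro continuous_intros h k)
    show "(\<lambda>q. (h q, k q)) \<in> {0..1} \<times> {0..1} \<rightarrow> torus"
      using h(2) k(2) by (auto simp: mem_torus Pi_iff)
    show "\<forall>x\<in>{0..1}. (h (0, x), k (0, x)) = \<gamma> x"
      using h(3) k(3) by (simp add: prod_eq_iff)
    show "\<forall>x\<in>{0..1}. (h (1, x), k (1, x)) = straight_loop a x"
      using h(4) k(4) by (simp add: straight_loop_def torus_cover_def lattice_vec_def)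
    show "\<forall>t\<in>{0..1}. pathfinish ((\<lambda>q. (h q, k q)) \<circ> Pair t) = pathstart ((\<lambda>q. (h q, k q)) \<circ> Pair t)"
      using h(5) k(5) by (simp add: pathfinish_def pathstart_def)
  qed
qed

lemma has_class_straight_loop: "has_class (straight_loop a) a"
proof -
  have "path (straight_loop a)"
    unfolding path_def straight_loop_def torus_cover_def by (intro continuous_intros)
  then show ?thesis
    by (auto simp: has_class_def homotopic_loops_refl path_image_def straight_loop_def torus_cover_def
        mem_torus pathfinish_def pathstart_def lattice_vec_def)
qed

lemma isotopic_imp_homotopic_loops:
  assumes "isotopic f g" "path \<gamma>" "path_image \<gamma> \<subseteq> torus" "pathfinish \<gamma> = pathstart \<gamma>"
  shows "homotopic_loops torus (f \<circ> \<gamma>) (g \<circ> \<gamma>)"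
proof -
  have "homotopic_with_canon (\<lambda>_. True) torus torus f g"
    using assms(1) unfolding isotopic_rel_def by (rule homotopic_with_mono) auto
  then show ?thesis
    by (rule homotopic_loops_compose) (rule assms)+
qed

section \<open>The parabolic flow and the twist\<close>

text \<open>In the coordinate \<open>x\<close> on the circle given by \<open>z = (1 + \<i> x) / (1 - \<i> x)\<close> this is the translation
  \<open>x \<mapsto> x + t\<close>, which fixes only \<open>\<infinity>\<close>, that is \<open>z = -1\<close>.\<close>

definition parabolic :: "real \<Rightarrow> complex \<Rightarrow> complex" where
  "parabolic t z = ((2 + \<i> * t) * z + \<i> * t) / ((2 - \<i> * t) - \<i> * t * z)"

lemma parabolic_denominator_nonzero:
  assumes "norm z = 1"
  shows "(2 - \<i> * of_real t) - \<i> * of_real t * z \<noteq> 0"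
proof
  assume eq: "(2 - \<i> * of_real t) - \<i> * of_real t * z = 0"
  then have re: "2 + t * Im z = 0" and im: "t * (1 + Re z) = 0"
    by (auto simp: complex_eq_iff algebra_simps)
  from re have "t \<noteq> 0"
    by auto
  with im have "Re z = - 1"
    by simp
  moreover have "Re z ^ 2 + Im z ^ 2 = 1"
    using assms by (metis cmod_power2 one_power2)
  ultimately have "Im z = 0"
    by simp
  with re show False
    by simp
qed

text \<open>For \<open>z\<close> on the unit circle the numerator is \<open>z\<close> times the
  conjugate of the denominator.\<close>

lemma norm_parabolic [simp]:
  assumes "norm z = 1"
  shows "norm (parabolic t z) = 1"
proof -
  let ?d = "(2 - \<i> * of_real t) - \<i> * of_real t * z"
  have "z * cnj z = 1"
    using assms by (simp add: complex_norm_square [symmetric])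
  then have "(2 + \<i> * of_real t) * z + \<i> * of_real t = z * cnj ?d"
    by (simp add: algebra_simps)
  then have "parabolic t z = z * cnj ?d / ?d"
    by (simp add: parabolic_def)
  then show ?thesis
    using parabolic_denominator_nonzero [OF assms, of t] assms
    by (simp only: norm_divide norm_mult complex_mod_cnj) simp
qed

lemma parabolic_0 [simp]: "parabolic 0 z = z"
  by (simp add: parabolic_def)

text \<open>The flow law: the coefficient matrices of the times \<open>s\<close> and
  \<open>t\<close> multiply to twice the matrix of \<open>s + t\<close>, and the factor 2 cancels in
  the quotient.\<close>

lemma parabolic_add:
  assumes "norm z = 1"
  shows "parabolic s (parabolic t z) = parabolic (s + t) z"
proof -
  define D where "D = (2 - \<i> * of_real t) - \<i> * of_real t * z"
  define N where "N = (2 + \<i> * of_real t) * z + \<i> * of_real t"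
  have D: "D \<noteq> 0"
    using parabolic_denominator_nonzero [OF assms] by (simp add: D_def)
  have "parabolic s (parabolic t z) =
      ((2 + \<i> * of_real s) * (N / D) + \<i> * of_real s) / ((2 - \<i> * of_real s) - \<i> * of_real s * (N / D))"
    by (simp add: parabolic_def D_def N_def)
  also have "\<dots> = (((2 + \<i> * of_real s) * N + \<i> * of_real s * D) / D)
      / (((2 - \<i> * of_real s) * D - \<i> * of_real s * N) / D)"
    using D by (simp add: field_simps)
  also have "\<dots> = ((2 + \<i> * of_real s) * N + \<i> * of_real s * D) / ((2 - \<i> * of_real s) * D - \<i> * of_real s * N)"
    using D by simp
  also have "(2 + \<i> * of_real s) * N + \<i> * of_real s * D =
      2 * ((2 + \<i> * of_real (s + t)) * z + \<i> * of_real (s + t))"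
    by (simp add: N_def D_def algebra_simps)
  also have "(2 - \<i> * of_real s) * D - \<i> * of_real s * N =
      2 * ((2 - \<i> * of_real (s + t)) - \<i> * of_real (s + t) * z)"
    by (simp add: N_def D_def algebra_simps)
  also have "2 * ((2 + \<i> * of_real (s + t)) * z + \<i> * of_real (s + t)) /
      (2 * ((2 - \<i> * of_real (s + t)) - \<i> * of_real (s + t) * z)) = parabolic (s + t) z"
    unfolding parabolic_def by (rule mult_divide_mult_cancel_left) simp
  finally show ?thesis .
qed

text \<open>The fixed point equation becomes \<open>\<i> * t * (z + 1) ^ 2 = 0\<close>; the double
  root is what makes the map parabolic.\<close>

lemma parabolic_fixed_iff:
  assumes "norm z = 1"
  shows "parabolic t z = z \<longleftrightarrow> t = 0 \<or> z = - 1"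
proof -
  have "parabolic t z = z \<longleftrightarrow> (2 + \<i> * t) * z + \<i> * t = z * ((2 - \<i> * t) - \<i> * t * z)"
    using parabolic_denominator_nonzero [OF assms, of t] by (simp add: parabolic_def divide_eq_eq)
  also have "\<dots> \<longleftrightarrow> \<i> * t * (z + 1) ^ 2 = 0"
    by (simp add: algebra_simps power2_eq_square)
  also have "\<dots> \<longleftrightarrow> t = 0 \<or> z = - 1"
    by (simp add: add_eq_0_iff2)
  finally show ?thesis .
qed

lemma continuous_on_parabolic:
  assumes "continuous_on X t" "continuous_on X z" "\<And>x. x \<in> X \<Longrightarrow> norm (z x) = 1"
  shows "continuous_on X (\<lambda>x. parabolic (t x) (z x))"
  unfolding parabolic_def
  by (intro continuous_intros assms) (use parabolic_denominator_nonzero assms in blast)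

text \<open>Concentrating the vertical twist away from \<open>-1\<close> makes the identity \<open>marking_shear\<close> below exact.\<close>

definition twist_factor :: "complex \<Rightarrow> complex" where
  "twist_factor z = (if Re z \<ge> 0 then z ^ 2 else - 1)"

text \<open>The gluing condition for the two branches of \<open>twist_factor\<close>.\<close>

lemma unit_Re_eq_0:
  assumes "norm z = 1" "Re z = 0"
  shows "z ^ 2 = - 1"
proof -
  have "Im z ^ 2 = 1"
    using assms cmod_power2 [of z] by simp
  with assms show ?thesis
    by (simp add: complex_eq_iff power2_eq_square)
qed

lemma continuous_on_Re_cases:
  assumes "continuous_on X z" "continuous_on X f" "continuous_on X g"
    and "\<And>x. x \<in> X \<Longrightarrow> Re (z x) = 0 \<Longrightarrow> f x = g x"
  shows "continuous_on X (\<lambda>x. if Re (z x) \<ge> 0 then f x else g x)"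
proof -
  have "continuous_on X (\<lambda>x. if - Re (z x) \<le> 0 then f x else g x)"
    by (rule continuous_on_cases_le)
      (use assms in \<open>auto intro!: continuous_intros intro: continuous_on_subset\<close>)
  then show ?thesis
    by simp
qed

lemma norm_twist_factor [simp]: "norm z = 1 \<Longrightarrow> norm (twist_factor z) = 1"
  by (simp add: twist_factor_def norm_power)

lemma twist_factor_nonzero [simp]: "norm z = 1 \<Longrightarrow> twist_factor z \<noteq> 0"
  by (metis norm_twist_factor norm_zero zero_neq_one)

lemma twist_factor_minus_1 [simp]: "twist_factor (- 1) = - 1"
  by (simp add: twist_factor_def)

lemma continuous_on_twist_factor:
  assumes "continuous_on X z" "\<And>x. x \<in> X \<Longrightarrow> norm (z x) = 1"
  shows "continuous_on X (\<lambda>x. twist_factor (z x))"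
  unfolding twist_factor_def
  by (intro continuous_on_Re_cases continuous_intros assms) (use unit_Re_eq_0 assms in blast)

text \<open>Up to a factor that stays in the closed right half-plane without the origin, and hence
  does not wind, \<open>twist_factor\<close> is the identity.\<close>

lemma winding_number_twist_factor:
  assumes z: "punctured_loop z" "\<And>t. t \<in> {0..1} \<Longrightarrow> norm (z t) = 1"
  shows "punctured_loop (\<lambda>t. twist_factor (z t))"
    "winding_number (\<lambda>t. twist_factor (z t)) 0 = winding_number z 0"
proof -
  \<comment> \<open>The quotient of \<open>twist_factor (z t)\<close> by \<open>z t\<close>: on the
    left half, \<open>- 1 / z\<close> equals \<open>- cnj z\<close> because \<open>z\<close> has
    norm one.\<close>
  define q where "q = (\<lambda>t. if Re (z t) \<ge> 0 then z t else - cnj (z t))"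
  have zq: "twist_factor (z t) = z t * q t" if "t \<in> {0..1}" for t
    using z(2) [OF that] complex_norm_square [of "z t"]
    by (simp add: q_def twist_factor_def power2_eq_square)
  have "continuous_on {0..1} q"
    unfolding q_def using z(1)
    by (intro continuous_on_Re_cases continuous_intros) (auto simp: punctured_loop_iff complex_eq_iff)
  then have q: "punctured_loop q"
    using z(1) by (auto simp: punctured_loop_iff q_def)
  have "winding_number q 0 = 0"
  proof (rule winding_number_slit_plane [OF q])
    fix t :: real
    assume t: "t \<in> {0..1}"
    show "q t \<notin> \<real>\<^sub>\<le>\<^sub>0"
    proof
      assume "q t \<in> \<real>\<^sub>\<le>\<^sub>0"
      then have "Re (q t) \<le> 0" "Im (q t) = 0"
        by (auto simp: complex_nonpos_Reals_iff)
      moreover have "Re (q t) \<ge> 0"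
        by (simp add: q_def)
      ultimately have "q t = 0"
        by (simp add: complex_eq_iff)
      with q t show False
        by (auto simp: punctured_loop_iff)
    qed
  qed
  moreover have "winding_number (\<lambda>t. twist_factor (z t)) 0 = winding_number (\<lambda>t. z t * q t) 0"
    by (rule winding_number_cong) (use zq in auto)
  ultimately show "winding_number (\<lambda>t. twist_factor (z t)) 0 = winding_number z 0"
    using winding_number_mult [OF z(1) q] by simp
  show "punctured_loop (\<lambda>t. twist_factor (z t))"
    using z by (auto simp: punctured_loop_iff intro!: continuous_on_twist_factor)
qed

text \<open>The time \<open>s\<close> of the horizontal flow and the rotation \<open>u\<close> of
  the vertical circles are parameters in order to join the example \<open>shear 1 1\<close> to maps
  that are easier to handle: \<open>shear 0 1\<close> for the action on loops,
  \<open>shear 0 (- 1)\<close> as an exact Dehn twist.\<close>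

definition shear :: "real \<Rightarrow> complex \<Rightarrow> torus_pt \<Rightarrow> torus_pt" where
  "shear s u p = (parabolic s (fst p), u * twist_factor (fst p) * snd p)"

lemma fst_shear_0: "fst (shear 0 u p) = fst p"
  by (simp add: shear_def)

lemma snd_shear: "snd (shear s u p) = u * twist_factor (fst p) * snd p"
  by (simp add: shear_def)

lemma continuous_on_shear:
  assumes "continuous_on X s" "continuous_on X u" "continuous_on X p" "\<And>x. x \<in> X \<Longrightarrow> p x \<in> torus"
  shows "continuous_on X (\<lambda>x. shear (s x) (u x) (p x))"
  unfolding shear_def
  by (intro continuous_intros continuous_on_parabolic continuous_on_twist_factor assms)
    (use assms mem_torus in blast)+

lemma shear_torus [simp]: "norm u = 1 \<Longrightarrow> p \<in> torus \<Longrightarrow> shear s u p \<in> torus"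
  by (simp add: mem_torus shear_def norm_mult)

lemma torus_homeo_shear:
  assumes u: "norm u = 1"
  shows "torus_homeo (shear s u)"
proof -
  \<comment> \<open>The inverse flows back in the base and then divides by the twist at the base
    point so recovered.\<close>
  define g where "g = (\<lambda>p :: torus_pt. (parabolic (- s) (fst p),
    snd p / (u * twist_factor (parabolic (- s) (fst p)))))"
  have u0: "u \<noteq> 0"
    using u by auto
  have "homeomorphism torus torus (shear s u) g"
  proof (rule homeomorphismI)
    show "continuous_on torus (shear s u)"
      by (rule continuous_on_shear) (auto intro: continuous_intros)
    show "continuous_on torus g"
      unfolding g_def
      by (intro continuous_intros continuous_on_parabolic continuous_on_twist_factor)
        (auto simp: mem_torus u0)
    show "shear s u ` torus \<subseteq> torus"
      using u by auto
    show "g ` torus \<subseteq> torus"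
      by (auto simp: g_def mem_torus norm_divide norm_mult u)
    show "g (shear s u p) = p" if "p \<in> torus" for p
      using that u0 by (cases p) (simp add: g_def shear_def mem_torus parabolic_add)
    show "shear s u (g p) = p" if "p \<in> torus" for p
      using that u0 by (cases p) (simp add: g_def shear_def mem_torus parabolic_add)
  qed
  then show ?thesis
    unfolding torus_homeo_def by blast
qed

lemma isotopic_rel_shear:
  fixes s :: "real \<Rightarrow> real" and u :: "real \<Rightarrow> complex"
  assumes s: "continuous_on {0..1} s" and u: "continuous_on {0..1} u" "\<And>t. t \<in> {0..1} \<Longrightarrow> norm (u t) = 1"
    and x: "\<And>t p. t \<in> {0..1} \<Longrightarrow> p \<in> x \<Longrightarrow> shear (s t) (u t) p = shear (s 0) (u 0) p"
  shows "isotopic_rel x (shear (s 0) (u 0)) (shear (s 1) (u 1))"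
  unfolding isotopic_rel_def homotopic_with_def
proof (intro exI [where x = "\<lambda>q. shear (s (fst q)) (u (fst q)) (snd q)"] conjI allI ballI)
  have "continuous_on ({0..1} \<times> torus) (\<lambda>q. shear (s (fst q)) (u (fst q)) (snd q))"
    by (intro continuous_on_shear continuous_on_compose2 [OF s] continuous_on_compose2 [OF u(1)]
        continuous_intros) auto
  moreover have "(\<lambda>q. shear (s (fst q)) (u (fst q)) (snd q)) \<in> {0..1} \<times> torus \<rightarrow> torus"
    using u(2) by auto
  ultimately show "continuous_map (prod_topology (top_of_set {0..1}) (top_of_set torus)) (top_of_set torus)
      (\<lambda>q. shear (s (fst q)) (u (fst q)) (snd q))"
    by simp
  fix t :: real
  assume t: "t \<in> {0..1}"
  show "torus_homeo (\<lambda>p. shear (s (fst (t, p))) (u (fst (t, p))) (snd (t, p)))"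
    using torus_homeo_shear u(2) [OF t] by simp
  show "shear (s (fst (t, p))) (u (fst (t, p))) (snd (t, p)) = shear (s 0) (u 0) p" if "p \<in> x" for p
    using x [OF t that] by simp
qed simp_all


section \<open>A shear homeomorphism whose periodic orbits are all translates of each other\<close>

abbreviation shear_map :: "torus_pt \<Rightarrow> torus_pt" where
  "shear_map \<equiv> shear 1 1"

definition twist_orbit :: "complex \<Rightarrow> torus_pt set" where
  "twist_orbit w = {(- 1, w), (- 1, - w)}"

text \<open>The first coordinate is kept. The second is multiplied by \<open>twist_factor\<close> of
  the first, which winds as often as the first coordinate itself.\<close>

lemma has_class_shear:
  assumes "has_class \<gamma> a" "norm u = 1"
  shows "has_class (shear 0 u \<circ> \<gamma>) (fst a, fst a + snd a)"
proof -
  have \<gamma>: "path \<gamma>" "path_image \<gamma> \<subseteq> torus" "pathfinish \<gamma> = pathstart \<gamma>"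
    using assms(1) by (auto simp: has_class_iff)
  then have norm: "norm (fst (\<gamma> t)) = 1" if "t \<in> {0..1}" for t
    using that unfolding path_image_def by (metis image_subset_iff mem_torus)
  note \<gamma>' = has_class_winding_numbers [OF assms(1)]
  note tw = winding_number_twist_factor [OF \<gamma>'(1) norm]
  have u0: "u \<noteq> 0"
    using assms(2) by auto
  have u: "punctured_loop (\<lambda>_. u)" "winding_number (\<lambda>_. u) 0 = 0"
    using u0 winding_number_const_loop by blast+
  have "winding_number (\<lambda>t. u * twist_factor (fst (\<gamma> t)) * snd (\<gamma> t)) 0 = of_int (fst a + snd a)"
    using winding_number_mult [OF punctured_loop_mult [OF u(1) tw(1)] \<gamma>'(2)]
      winding_number_mult [OF u(1) tw(1)] tw(2) u(2) \<gamma>'(3,4) by simp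
  moreover have "path (shear 0 u \<circ> \<gamma>)"
    using \<gamma> by (intro path_continuous_image continuous_on_shear) (auto intro: continuous_intros)
  ultimately show ?thesis
    using \<gamma> \<gamma>'(3) assms(2) unfolding has_class_iff
    by (auto simp: pathfinish_def pathstart_def path_image_def fst_shear_0 snd_shear o_def image_subset_iff)
qed

lemma isotopic_shear_map: "isotopic shear_map (shear 0 1)"
proof -
  have "isotopic (shear (1 - 0) 1) (shear (1 - 1) 1)"
    by (rule isotopic_rel_shear [of "\<lambda>t. 1 - t" "\<lambda>_. 1"]) (auto intro!: continuous_intros)
  then show ?thesis
    by simp
qed

lemma has_class_shear_map:
  assumes "has_class \<gamma> a"
  shows "has_class (shear_map \<circ> \<gamma>) (fst a, fst a + snd a)"
proof -
  have "path \<gamma>" "path_image \<gamma> \<subseteq> torus" "pathfinish \<gamma> = pathstart \<gamma>"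
    using assms by (simp_all only: has_class_iff)
  then have "homotopic_loops torus (shear_map \<circ> \<gamma>) (shear 0 1 \<circ> \<gamma>)"
    by (rule isotopic_imp_homotopic_loops [OF isotopic_shear_map])
  moreover have "has_class (shear 0 1 \<circ> \<gamma>) (fst a, fst a + snd a)"
    by (rule has_class_shear [OF assms]) simp
  ultimately show ?thesis
    unfolding has_class_def by (rule homotopic_loops_trans)
qed

text \<open>The action on homology takes \<open>(i, j)\<close> to \<open>(i, i + j)\<close>. This
  forces \<open>b\<close> to be \<open>(0, fst a)\<close>, and the determinant becomes the square of
  \<open>fst a\<close>.\<close>

lemma standard_axes_shear_map:
  "standard_axes a b shear_map \<longleftrightarrow> fst b = 0 \<and> snd b = fst a \<and> \<bar>fst a\<bar> = 1"
proof -
  have iff: "has_class (shear_map \<circ> straight_loop c) d \<longleftrightarrow> fst d = fst c \<and> snd d = fst c + snd c" for c d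
  proof
    assume d: "has_class (shear_map \<circ> straight_loop c) d"
    note c = has_class_shear_map [OF has_class_straight_loop, of c]
    show "fst d = fst c \<and> snd d = fst c + snd c"
      using has_class_winding_numbers(3,4) [OF d] has_class_winding_numbers(3,4) [OF c]
      by (simp flip: of_int_add)
  next
    assume "fst d = fst c \<and> snd d = fst c + snd c"
    then have "d = (fst c, fst c + snd c)"
      by (simp add: prod_eq_iff)
    then show "has_class (shear_map \<circ> straight_loop c) d"
      using has_class_shear_map [OF has_class_straight_loop] by simp
  qed
  have "standard_axes a b shear_map \<longleftrightarrow>
      \<bar>fst a * snd b - snd a * fst b\<bar> = 1 \<and> fst b = 0 \<and> snd b = fst a"
    unfolding standard_axes_def iff fst_add snd_add by linarith
  also have "\<dots> \<longleftrightarrow> fst b = 0 \<and> snd b = fst a \<and> \<bar>fst a\<bar> * \<bar>fst a\<bar> = 1"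
    by (metis abs_mult diff_zero mult_zero_right)
  also have "\<bar>fst a\<bar> * \<bar>fst a\<bar> = 1 \<longleftrightarrow> \<bar>fst a\<bar> = 1"
    by (simp only: zmult_eq_1_iff) linarith
  finally show ?thesis .
qed

text \<open>Stopping the flow and rotating the vertical circles by half a turn leads to
  \<open>shear 0 (- 1)\<close>. This is the identity where \<open>Re z < 0\<close> and a Dehn twist
  on the annulus \<open>Re z \<ge> 0\<close>, whose core \<open>z = 1\<close> is essential.\<close>

lemma shear_type_shear_map: "shear_type shear_map"
proof -
  \<comment> \<open>The angle runs from \<open>- pi / 2\<close> to \<open>pi / 2\<close>, so
    \<open>A\<close> fills the right half of the torus, and \<open>- (z ^ 2)\<close> is
    \<open>cis (2 * pi * t)\<close> there.\<close>
  define A :: "complex \<times> real \<Rightarrow> torus_pt" where "A = (\<lambda>(w, t). (cis (pi * (t - 1/2)), w))"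
  define c :: "real \<Rightarrow> torus_pt" where "c = (\<lambda>s. (1, cis (2 * pi * s)))"
  have isotopic: "isotopic shear_map (shear 0 (- 1))"
  proof -
    have "isotopic (shear (1 - 0) (cis (pi * 0))) (shear (1 - 1) (cis (pi * 1)))"
      by (rule isotopic_rel_shear [of "\<lambda>t. 1 - t" "\<lambda>t. cis (pi * t)"]) (auto intro!: continuous_intros)
    then show ?thesis
      by simp
  qed
  have "has_class c (0, 1)"
    using winding_number_cis [of 1] winding_number_cis [of 0]
    by (auto simp: has_class_iff c_def path_def path_image_def mem_torus pathfinish_def pathstart_def
        intro!: continuous_intros)
  have essential: "\<nexists>p. homotopic_loops torus c (\<lambda>_. p)"
  proof
    assume "\<exists>p. homotopic_loops torus c (\<lambda>_. p)"
    then obtain p where p: "homotopic_loops torus c (\<lambda>_. p)" ..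
    then have "p \<in> torus"
      using homotopic_loops_imp_subset by (fastforce simp: path_image_def)
    \<comment> \<open>A constant loop does not wind, but the second coordinate of \<open>c\<close>
      winds once.\<close>
    have "winding_number (\<lambda>t. snd (c t)) 0 = winding_number (\<lambda>t. snd p) 0"
      by (rule winding_number_homotopic_compose [OF p]) (auto simp: mem_torus intro: continuous_intros)
    moreover have "winding_number (\<lambda>t. snd p) 0 = 0"
      using \<open>p \<in> torus\<close> by (intro winding_number_const_loop) (auto simp: mem_torus)
    ultimately show False
      using has_class_winding_numbers(4) [OF \<open>has_class c (0, 1)\<close>] by simp
  qed
  have angle: "- (pi / 2) \<le> pi * (t - 1/2) \<and> pi * (t - 1/2) \<le> pi / 2" if "t \<in> {0..1}" for t :: real
  proof -
    have "pi * (- 1/2) \<le> pi * (t - 1/2)" "pi * (t - 1/2) \<le> pi * (1/2)"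
      using that by (intro mult_left_mono; simp)+
    then show ?thesis
      by simp
  qed
  then have Re_A: "Re (cis (pi * (t - 1/2))) \<ge> 0" if "t \<in> {0..1}" for t
    using that cos_ge_zero [of "pi * (t - 1/2)"] by simp
  have image_A: "p \<in> A ` (sphere 0 1 \<times> {0..1})" if p: "p \<in> torus" "Re (fst p) \<ge> 0" for p
  proof -
    obtain z w where zw: "p = (z, w)"
      by (cases p)
    have z: "Re z ^ 2 + Im z ^ 2 = 1"
      using p(1) zw cmod_power2 [of z] by (simp add: mem_torus)
    then have "Im z ^ 2 \<le> 1"
      by (metis le_add_same_cancel2 zero_le_power2)
    then have im: "- 1 \<le> Im z" "Im z \<le> 1"
      using abs_square_le_1 [of "Im z"] by auto
    have "cis (arcsin (Im z)) = z"
      using im z p(2) zw by (simp add: complex_eq_iff cos_arcsin real_sqrt_unique)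
    then have "A (w, arcsin (Im z) / pi + 1/2) = p"
      by (simp add: A_def zw)
    moreover have "arcsin (Im z) / pi + 1/2 \<in> {0..1}"
      using arcsin_bounded [OF im] by (auto simp: field_simps)
    ultimately show ?thesis
      using p(1) zw by (force simp: mem_torus)
  qed
  have "dehn_twist_along c (shear 0 (- 1))"
    unfolding dehn_twist_along_def
  proof (intro exI [where x = A] conjI ballI)
    show "continuous_on (sphere 0 1 \<times> {0..1}) A"
      unfolding A_def case_prod_unfold by (intro continuous_intros)
    show "inj_on A (sphere 0 1 \<times> {0..1})"
    proof (rule inj_onI)
      fix p q assume pq: "p \<in> sphere 0 1 \<times> {0..1}" "q \<in> sphere 0 1 \<times> {0..1}" "A p = A q"
      \<comment> \<open>The sine alone determines the angle, which lies in the range of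
        \<open>arcsin\<close>.\<close>
      have "sin (pi * (snd p - 1/2)) = sin (pi * (snd q - 1/2))"
        using pq(3) by (auto simp: A_def case_prod_unfold cis.code)
      then have "pi * (snd p - 1/2) = pi * (snd q - 1/2)"
        using angle [of "snd p"] angle [of "snd q"] pq by (metis arcsin_sin mem_Times_iff)
      then show "p = q"
        using pq(3) by (auto simp: A_def case_prod_unfold prod_eq_iff)
    qed
    show "A ` (sphere 0 1 \<times> {0..1}) \<subseteq> torus"
      by (auto simp: A_def mem_torus)
    show "c s = A (cis (2 * pi * s), 1/2)" for s
      by (simp add: c_def A_def)
    show "shear 0 (- 1) (A (z, t)) = A (z * cis (2 * pi * t), t)"
      if "z \<in> sphere 0 1" "t \<in> {0..1}" for z t
    proof -
      have "- (cis (pi * (t - 1/2)) ^ 2) = cis pi * cis (2 * (pi * (t - 1/2)))"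
        by (simp add: Complex.DeMoivre)
      also have "\<dots> = cis (2 * pi * t)"
        by (simp only: cis_mult) (simp add: algebra_simps)
      finally show ?thesis
        using Re_A [OF that(2)] by (simp add: A_def shear_def twist_factor_def del: cis.sel)
    qed
    show "shear 0 (- 1) p = p" if "p \<in> torus - A ` (sphere 0 1 \<times> {0..1})" for p
      using that image_A [of p] by (auto simp: shear_def twist_factor_def)
  qed
  then show ?thesis
    using essential isotopic unfolding shear_type_def by blast
qed

section \<open>Periodic orbits of the example\<close>

lemma parabolic_minus_1 [simp]: "parabolic t (- 1) = - 1"
  by (simp add: parabolic_fixed_iff)

lemma fst_shear: "fst (shear s u p) = parabolic s (fst p)"
  by (simp add: shear_def)

lemma shear_map_funpow:
  assumes "p \<in> torus"
  shows "(shear_map ^^ n) p \<in> torus \<and> fst ((shear_map ^^ n) p) = parabolic (real n) (fst p)"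
proof (induction n)
  case (Suc n)
  then have "fst (shear_map ((shear_map ^^ n) p)) = parabolic 1 (parabolic (real n) (fst p))"
    by (simp add: fst_shear)
  also have "\<dots> = parabolic (real (Suc n)) (fst p)"
    using assms by (simp add: parabolic_add mem_torus)
  finally show ?case
    using Suc by simp
qed (use assms in auto)

lemma shear_map_twist_orbit: "shear_map (- 1, w) = (- 1, - w)"
  by (simp add: shear_def)

text \<open>The first coordinate of a returning point is fixed by the flow at a positive time, so
  the point lies on the circle \<open>z = - 1\<close>, where the map takes \<open>w\<close> to
  \<open>- w\<close>.\<close>

lemma periodic_orbit_shear_map:
  "periodic_orbit shear_map y \<longleftrightarrow> (\<exists>w. norm w = 1 \<and> y = twist_orbit w)"
proof
  assume "periodic_orbit shear_map y"
  then obtain p n where p: "p \<in> torus" "n > 0" "(shear_map ^^ n) p = p"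
    and y: "y = (\<lambda>j. (shear_map ^^ j) p) ` {..<n}"
    unfolding periodic_orbit_def by blast
  define w where "w = snd p"
  have "parabolic (real n) (fst p) = fst p"
    using shear_map_funpow [OF p(1), of n] p(3) by simp
  then have pw: "p = (- 1, w)" and w: "norm w = 1"
    using p(1,2) by (auto simp: parabolic_fixed_iff mem_torus w_def prod_eq_iff)
  have iter: "(shear_map ^^ j) p = (- 1, (- 1) ^ j * w)" for j
    by (induction j) (simp_all add: pw shear_map_twist_orbit)
  \<comment> \<open>The definition of \<open>periodic_orbit\<close> does not ask for the least
    period, so \<open>n\<close> is an arbitrary positive return time and only its parity is
    determined.\<close>
  have "even n"
  proof (rule ccontr)
    assume "odd n"
    then have "- w = w"
      using p(3) iter [of n] pw by simp
    with w show False
      by auto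
  qed
  with \<open>n > 0\<close> have "1 < n"
    by (cases "n = 1") auto
  have "y = twist_orbit w"
  proof
    show "y \<subseteq> twist_orbit w"
      using y iter by (auto simp: twist_orbit_def minus_one_power_iff)
    have "(- 1, (- 1) ^ j * w) \<in> y" if "j < n" for j
      using that unfolding y iter [symmetric] by simp
    from this [of 0] this [of 1] show "twist_orbit w \<subseteq> y"
      using \<open>1 < n\<close> by (simp add: twist_orbit_def)
  qed
  with w show "\<exists>w. norm w = 1 \<and> y = twist_orbit w"
    by blast
next
  assume "\<exists>w. norm w = 1 \<and> y = twist_orbit w"
  then obtain w where w: "norm w = 1" "y = twist_orbit w"
    by blast
  have "{..<2::nat} = {0, 1}"
    by auto
  then have "y = (\<lambda>j. (shear_map ^^ j) (- 1, w)) ` {..<2}"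
    by (simp add: w twist_orbit_def shear_map_twist_orbit)
  moreover have "(shear_map ^^ 2) (- 1, w) = (- 1, w)"
    by (simp add: numeral_2_eq_2 shear_map_twist_orbit)
  moreover have "(- 1, w) \<in> torus"
    using w by (simp add: mem_torus)
  ultimately show "periodic_orbit shear_map y"
    unfolding periodic_orbit_def by (intro bexI [of _ "(- 1, w)"] exI [of _ 2]) simp_all
qed

section \<open>Similarity of translated orbits and twist type\<close>

lemma torus_homeo_cong: "(\<And>p. p \<in> torus \<Longrightarrow> f p = g p) \<Longrightarrow> torus_homeo f \<longleftrightarrow> torus_homeo g"
  unfolding torus_homeo_def by (metis homeomorphism_cong)

lemma torus_homeo_compose: "torus_homeo f \<Longrightarrow> torus_homeo g \<Longrightarrow> torus_homeo (f \<circ> g)"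
  unfolding torus_homeo_def by (metis homeomorphism_compose)

text \<open>The similarity is inverted and followed by a symmetry \<open>V\<close> of
  \<open>f\<close>: the map \<open>V \<circ> h'\<close> takes \<open>y\<close> to \<open>x\<close>
  and then to its image under \<open>V\<close>. It conjugates \<open>g\<close>, up to isotopy, to
  \<open>V \<circ> f \<circ> V'\<close>, which is \<open>f\<close> on the torus.\<close>

lemma similar_orbits_commuting_homeo:
  assumes sim: "similar_orbits x f y g"
    and V: "homeomorphism torus torus V V'" "isotopic id V"
    and comm: "\<And>p. p \<in> torus \<Longrightarrow> V (f p) = f (V p)"
    and x: "x \<subseteq> torus" and f: "f ` torus \<subseteq> torus"
  shows "similar_orbits y g (V ` x) f"
proof -
  obtain h h' where h: "homeomorphism torus torus h h'" "isotopic id h" "h ` x = y"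
    and iso: "isotopic_rel y (h \<circ> f \<circ> h') g"
    using sim unfolding similar_orbits_def by blast
  have h_inv: "h p \<in> torus" "h' p \<in> torus" "h' (h p) = p" "h (h' p) = p" if "p \<in> torus" for p
    using h(1) that unfolding homeomorphism_def by blast+
  have V_inv: "V p \<in> torus" "V' p \<in> torus" "V' (V p) = p" "V (V' p) = p" if "p \<in> torus" for p
    using V(1) that unfolding homeomorphism_def by blast+
  have fp: "f p \<in> torus" if "p \<in> torus" for p
    using f that by blast
  have homeo: "torus_homeo h" "torus_homeo h'" "torus_homeo V" "torus_homeo V'"
    using h(1) V(1) homeomorphism_symD unfolding torus_homeo_def by blast+
  have "continuous_map (top_of_set torus) (top_of_set torus) h"
    "continuous_map (top_of_set torus) (top_of_set torus) V'"
    and cont: "continuous_map (top_of_set torus) (top_of_set torus) h'"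
    "continuous_map (top_of_set torus) (top_of_set torus) V"
    using h(1) V(1) by (auto simp: homeomorphism_def)
  then have cont2: "continuous_map (top_of_set torus) (top_of_set torus) (V \<circ> h')"
    "continuous_map (top_of_set torus) (top_of_set torus) (h \<circ> V')"
    using continuous_map_compose by blast+
  have iso_id: "homotopic_with_canon torus_homeo torus torus id h"
    "homotopic_with_canon torus_homeo torus torus id V"
    using h(2) V(2) by (simp_all add: isotopic_rel_def)
  let ?k = "V \<circ> h'" and ?k' = "h \<circ> V'"
  \<comment> \<open>Composing the isotopy from \<open>id\<close> to \<open>h\<close> with
    \<open>h'\<close> on the right joins \<open>h'\<close> to the identity.\<close>
  have "homotopic_with_canon torus_homeo torus torus (id \<circ> h') (h \<circ> h')"
    by (rule homotopic_with_compose_continuous_map_right [OF iso_id(1) cont(1)])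
      (rule torus_homeo_compose [OF _ homeo(2)])
  then have "homotopic_with_canon torus_homeo torus torus (V \<circ> (id \<circ> h')) (V \<circ> (h \<circ> h'))"
    by (rule homotopic_with_compose_continuous_map_left [OF _ cont(2)])
      (rule torus_homeo_compose [OF homeo(3)])
  then have "homotopic_with_canon torus_homeo torus torus ?k V"
  proof (rule homotopic_with_eq)
    show "torus_homeo \<phi> \<longleftrightarrow> torus_homeo \<psi>"
      if "\<And>p. p \<in> topspace (top_of_set torus) \<Longrightarrow> \<phi> p = \<psi> p" for \<phi> \<psi>
      using that by (intro torus_homeo_cong) simp
  qed (simp_all add: h_inv)
  then have "isotopic id ?k"
    using homotopic_with_trans [OF iso_id(2) homotopic_with_symD] by (simp add: isotopic_rel_def)
  moreover have "homeomorphism torus torus ?k ?k'"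
    using homeomorphism_compose [OF homeomorphism_symD [OF h(1)] V(1)] .
  moreover have "?k ` y = V ` x"
    unfolding h(3) [symmetric] image_image comp_def
    by (rule image_cong) (use x h_inv(3) in auto)
  moreover have "isotopic_rel (V ` x) (?k \<circ> g \<circ> ?k') f"
  proof -
    let ?P = "\<lambda>\<phi>. torus_homeo \<phi> \<and> (\<forall>z\<in>y. \<phi> z = (h \<circ> f \<circ> h') z)"
    let ?Q = "\<lambda>\<phi>. torus_homeo \<phi> \<and> (\<forall>z\<in>V ` x. \<phi> z = (?k \<circ> g \<circ> ?k') z)"
    have g: "g (h p) = h (f p)" if "p \<in> x" for p
    proof -
      have "\<forall>z\<in>y. g z = (h \<circ> f \<circ> h') z"
        using homotopic_with_imp_property [OF iso [unfolded isotopic_rel_def]] by simp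
      moreover have "h p \<in> y" "p \<in> torus"
        using that h(3) x by blast+
      ultimately show ?thesis
        by (simp add: h_inv)
    qed
    \<comment> \<open>Conjugation by \<open>?k\<close> turns maps prescribed on \<open>y\<close>
      into maps prescribed on the image of \<open>x\<close>, so the whole relative isotopy can be
      conjugated.\<close>
    have Q: "?Q (?k \<circ> (\<phi> \<circ> ?k'))" if "?P \<phi>" for \<phi>
    proof
      show "torus_homeo (?k \<circ> (\<phi> \<circ> ?k'))"
        using that by (intro torus_homeo_compose homeo) auto
      show "\<forall>z\<in>V ` x. (?k \<circ> (\<phi> \<circ> ?k')) z = (?k \<circ> g \<circ> ?k') z"
      proof
        fix z assume "z \<in> V ` x"
        then obtain p where p: "p \<in> x" "z = V p"
          by blast
        then have "p \<in> torus"
          using x by blast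
        then have "\<phi> (h p) = g (h p)"
          using that p(1) h(3) g [OF p(1)] h_inv(3) by (metis comp_apply imageI)
        then show "(?k \<circ> (\<phi> \<circ> ?k')) z = (?k \<circ> g \<circ> ?k') z"
          using p \<open>p \<in> torus\<close> V_inv by simp
      qed
    qed
    have "homotopic_with_canon (\<lambda>\<phi>. ?P \<phi>) torus torus (h \<circ> f \<circ> h') g"
      using iso by (simp add: isotopic_rel_def)
    then have "homotopic_with_canon (\<lambda>\<phi>. ?Q (?k \<circ> \<phi>)) torus torus ((h \<circ> f \<circ> h') \<circ> ?k') (g \<circ> ?k')"
      by (rule homotopic_with_compose_continuous_map_right [OF _ cont2(2)]) (rule Q)
    then have "homotopic_with_canon ?Q torus torus (?k \<circ> ((h \<circ> f \<circ> h') \<circ> ?k')) (?k \<circ> (g \<circ> ?k'))"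
      by (rule homotopic_with_compose_continuous_map_left [OF _ cont2(1)])
    then have "homotopic_with_canon ?Q torus torus f (?k \<circ> g \<circ> ?k')"
    proof (rule homotopic_with_eq)
      show "f p = (?k \<circ> ((h \<circ> f \<circ> h') \<circ> ?k')) p" if "p \<in> topspace (top_of_set torus)" for p
        using that by (simp add: h_inv V_inv fp comm)
      show "?Q \<phi> \<longleftrightarrow> ?Q \<psi>" if "\<And>p. p \<in> topspace (top_of_set torus) \<Longrightarrow> \<phi> p = \<psi> p" for \<phi> \<psi>
      proof -
        have "V ` x \<subseteq> torus"
          using x V_inv(1) by blast
        with that have "\<phi> p = \<psi> p" if "p \<in> V ` x" for p
          using \<open>p \<in> V ` x\<close> by (metis subsetD topspace_euclidean_subtopology)
        moreover have "torus_homeo \<phi> \<longleftrightarrow> torus_homeo \<psi>"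
          using that by (intro torus_homeo_cong) simp
        ultimately show ?thesis
          by (intro conj_cong ball_cong refl) simp_all
      qed
    qed simp
    then show ?thesis
      unfolding isotopic_rel_def by (rule homotopic_with_symD)
  qed
  ultimately show ?thesis
    unfolding similar_orbits_def by blast
qed

text \<open>Forcing is tested on \<open>shear_map\<close> itself: the forced type then occurs among
  its own periodic orbits, all of which are vertical translates of
  \<open>twist_orbit 1\<close>.\<close>

lemma twist_type_shear_map: "twist_type a b (twist_orbit 1) shear_map"
  unfolding twist_type_def
proof (intro allI impI, elim conjE)
  fix y g
  assume "forces (twist_orbit 1) shear_map y g"
  moreover have "isotopic_rel (twist_orbit 1) shear_map shear_map"
    using torus_homeo_shear [of 1 1] unfolding isotopic_rel_def
    by (auto simp: torus_homeo_def homeomorphism_def)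
  ultimately obtain y' where y': "periodic_orbit shear_map y'" "similar_orbits y' shear_map y g"
    unfolding forces_def by blast
  then obtain w where w: "norm w = 1" "y' = twist_orbit w"
    using periodic_orbit_shear_map by blast
  \<comment> \<open>Vertical rotations commute with the shear, and the one by
    \<open>inverse w\<close> takes \<open>twist_orbit w\<close> to
    \<open>twist_orbit 1\<close>.\<close>
  define V where "V = (\<lambda>u (p :: torus_pt). (fst p, u * snd p))"
  have V: "homeomorphism torus torus (V u) (V (inverse u))" if "norm u = 1" for u
  proof -
    have "u \<noteq> 0"
      using that by auto
    then show ?thesis
      using that
      by (intro homeomorphismI) (auto simp: V_def mem_torus norm_mult norm_inverse intro!: continuous_intros)
  qed
  obtain \<theta> where \<theta>: "inverse w = cis \<theta>"
    using w(1) by (metis cis_Arg norm_inverse inverse_1 norm_zero sgn_eq div_by_1 of_real_1 zero_neq_one)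
  have "isotopic id (V (inverse w))"
    unfolding isotopic_rel_def homotopic_with_def
  proof (intro exI [where x = "\<lambda>q. V (cis (\<theta> * fst q)) (snd q)"] conjI allI ballI)
    have "continuous_on ({0..1} \<times> torus) (\<lambda>q. V (cis (\<theta> * fst q)) (snd q))"
      unfolding V_def by (intro continuous_intros)
    then show "continuous_map (prod_topology (top_of_set {0..1}) (top_of_set torus)) (top_of_set torus)
        (\<lambda>q. V (cis (\<theta> * fst q)) (snd q))"
      by (auto simp: V_def mem_torus norm_mult)
    show "torus_homeo (\<lambda>p. V (cis (\<theta> * fst (t, p))) (snd (t, p)))" for t
      using V [of "cis (\<theta> * t)"] by (auto simp: torus_homeo_def)
  qed (auto simp: V_def \<theta>)
  moreover have "V (inverse w) (shear_map p) = shear_map (V (inverse w) p)" for p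
    by (simp add: V_def shear_def)
  moreover have "V (inverse w) ` y' = twist_orbit 1"
  proof -
    have "w \<noteq> 0"
      using w by auto
    then show ?thesis
      by (simp add: w(2) V_def twist_orbit_def)
  qed
  ultimately show "similar_orbits y g (twist_orbit 1) shear_map"
    using similar_orbits_commuting_homeo [OF y'(2) V [of "inverse w"]] w
    by (simp add: norm_inverse image_subset_iff) (simp add: twist_orbit_def mem_torus)
qed

section \<open>The orbit is not simple\<close>

text \<open>On the torus \<open>marking\<close> vanishes exactly at the two points of the orbit, with indices of opposite
  sign. Its winding number along a loop is therefore the coordinate of the homology class in the
  complement of the orbit that the torus does not see.\<close>

definition marking :: "torus_pt \<Rightarrow> complex" where
  "marking p = (if Re (fst p) \<ge> 0 then fst p else Complex (- Re (fst p) * Im (snd p)) (Im (fst p)))"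

lemma continuous_on_marking: "continuous_on X marking"
  unfolding marking_def
  by (intro continuous_on_Re_cases continuous_on_Complex continuous_intros) (simp add: complex_eq_iff)

lemma marking_eq_0_iff:
  assumes "p \<in> torus"
  shows "marking p = 0 \<longleftrightarrow> p \<in> twist_orbit 1"
proof -
  have eq: "Re (fst p) ^ 2 + Im (fst p) ^ 2 = 1" "Re (snd p) ^ 2 + Im (snd p) ^ 2 = 1"
    using assms cmod_power2 [of "fst p"] cmod_power2 [of "snd p"] by (simp_all add: mem_torus)
  show ?thesis
  proof (cases "Re (fst p) \<ge> 0")
    case True
    then show ?thesis
      using assms by (auto simp: marking_def mem_torus twist_orbit_def)
  next
    case False
    then have "marking p = 0 \<longleftrightarrow> Im (snd p) = 0 \<and> Im (fst p) = 0"
      by (auto simp: marking_def complex_eq_iff)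
    also have "\<dots> \<longleftrightarrow> fst p = - 1 \<and> (snd p = 1 \<or> snd p = - 1)"
      using eq False by (auto simp: complex_eq_iff power2_eq_1_iff)
    finally show ?thesis
      by (auto simp: twist_orbit_def prod_eq_iff)
  qed
qed

text \<open>On the right half, \<open>cnj z * z ^ 2 = z\<close>. On the left half the second
  coordinate is negated, so the real part of \<open>marking\<close> changes sign; conjugating and
  multiplying by \<open>- 1\<close> has the same effect.\<close>

lemma marking_shear:
  assumes "p \<in> torus"
  shows "marking (shear 0 1 p) = cnj (marking p) * twist_factor (fst p)"
proof (cases "Re (fst p) \<ge> 0")
  case True
  have "cnj (fst p) * fst p ^ 2 = (fst p * cnj (fst p)) * fst p"
    by (simp add: power2_eq_square)
  also have "\<dots> = fst p"
    using assms by (simp add: mem_torus complex_norm_square [symmetric])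
  finally show ?thesis
    using True by (simp add: marking_def fst_shear_0 twist_factor_def)
next
  case False
  then show ?thesis
    by (simp add: marking_def shear_def twist_factor_def complex_eq_iff)
qed

text \<open>A loop around the orbit point \<open>(-1, 1)\<close>.\<close>

definition point_loop :: "real \<Rightarrow> torus_pt" where
  "point_loop t = (- cis (sin (2 * pi * t)), cis (cos (2 * pi * t)))"

lemma cos_pos_abs_le_1:
  fixes x :: real
  assumes "\<bar>x\<bar> \<le> 1"
  shows "cos x > 0"
  using assms pi_gt3 by (intro cos_gt_zero_pi) linarith+

lemma mult_sin_nonneg:
  fixes x :: real
  assumes "\<bar>x\<bar> \<le> 1"
  shows "sin x * x \<ge> 0 \<and> (sin x * x = 0 \<longrightarrow> x = 0)"
proof -
  have pos: "sin y > 0" if "0 < y" "y \<le> 1" for y :: real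
    using that pi_gt3 by (intro sin_gt_zero) linarith+
  consider "x = 0" | "x > 0" | "x < 0"
    by linarith
  then show ?thesis
  proof cases
    case 2
    then show ?thesis
      using pos [of x] assms by simp
  next
    case 3
    then have "sin x < 0"
      using pos [of "- x"] assms by simp
    with 3 show ?thesis
      by (simp add: mult_nonpos_nonpos)
  qed simp
qed

text \<open>The loop goes around one zero of \<open>marking\<close> only, so \<open>marking\<close>
  winds an odd number of times while neither coordinate winds. Multiplying \<open>marking\<close> by
  powers of the coordinates cannot change this.\<close>

lemma point_loop:
  shows "path point_loop" "pathfinish point_loop = pathstart point_loop"
    "path_image point_loop \<subseteq> torus - twist_orbit 1"
    "winding_number (\<lambda>t. marking (point_loop t)) 0 = - 1"
    "winding_number (\<lambda>t. fst (point_loop t)) 0 = 0"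
    "winding_number (\<lambda>t. snd (point_loop t)) 0 = 0"
proof -
  show path: "path point_loop"
    unfolding path_def point_loop_def by (intro continuous_intros)
  show loop: "pathfinish point_loop = pathstart point_loop"
    by (simp add: point_loop_def pathfinish_def pathstart_def)
  have torus: "point_loop t \<in> torus" for t
    by (simp add: mem_torus point_loop_def)
  \<comment> \<open>For \<open>\<theta> = 2 * pi * t\<close> the values of \<open>marking\<close>
    roughly follow \<open>cis (- \<theta>)\<close>. Multiplying by \<open>cis \<theta>\<close>
    brings them into the right half-plane and adds one to the winding number.\<close>
  define r where "r = (\<lambda>t. marking (point_loop t) * cis (2 * pi * (t * of_int 1)))"
  have Re_r: "Re (r t) > 0" for t
  proof -
    define \<theta> where "\<theta> = 2 * pi * t"
    have c: "cos (sin \<theta>) > 0"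
      by (rule cos_pos_abs_le_1) simp
    then have "marking (point_loop t) = Complex (cos (sin \<theta>) * sin (cos \<theta>)) (- sin (sin \<theta>))"
      by (simp add: marking_def point_loop_def \<theta>_def)
    then have eq: "Re (r t) = cos (sin \<theta>) * (sin (cos \<theta>) * cos \<theta>) + sin (sin \<theta>) * sin \<theta>"
      by (simp add: r_def \<theta>_def mult.assoc)
    have nn: "sin (cos \<theta>) * cos \<theta> \<ge> 0 \<and> (sin (cos \<theta>) * cos \<theta> = 0 \<longrightarrow> cos \<theta> = 0)"
      "sin (sin \<theta>) * sin \<theta> \<ge> 0 \<and> (sin (sin \<theta>) * sin \<theta> = 0 \<longrightarrow> sin \<theta> = 0)"
      by (rule mult_sin_nonneg; simp)+
    have "cos \<theta> \<noteq> 0 \<or> sin \<theta> \<noteq> 0"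
      using sin_cos_squared_add [of \<theta>] by (metis add_0 power_zero_numeral zero_neq_one)
    then show ?thesis
    proof
      assume "cos \<theta> \<noteq> 0"
      then have "cos (sin \<theta>) * (sin (cos \<theta>) * cos \<theta>) > 0"
        using nn(1) by (intro mult_pos_pos [OF c]) linarith
      with eq nn(2) show ?thesis
        by linarith
    next
      assume "sin \<theta> \<noteq> 0"
      then have "sin (sin \<theta>) * sin \<theta> > 0"
        using nn(2) by linarith
      moreover have "cos (sin \<theta>) * (sin (cos \<theta>) * cos \<theta>) \<ge> 0"
        using nn(1) c by simp
      ultimately show ?thesis
        using eq by linarith
    qed
  qed
  then have nz: "marking (point_loop t) \<noteq> 0" for t
    unfolding r_def by (metis less_irrefl mult_zero_left zero_complex.sel(1))
  then show image: "path_image point_loop \<subseteq> torus - twist_orbit 1"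
    using torus marking_eq_0_iff by (auto simp: path_image_def)
  have mark: "punctured_loop (\<lambda>t. marking (point_loop t))"
    by (rule punctured_loop_compose [OF path loop image])
      (use marking_eq_0_iff continuous_on_marking in auto)
  note c = winding_number_cis [of 1]
  have "winding_number r 0 = winding_number (\<lambda>t. marking (point_loop t)) 0 + 1"
    unfolding r_def using winding_number_mult [OF mark] c by (metis of_int_1)
  moreover have "winding_number r 0 = 0"
  proof (rule winding_number_slit_plane)
    show "punctured_loop r"
      unfolding r_def by (rule punctured_loop_mult [OF mark]) (use c in blast)
    show "r t \<notin> \<real>\<^sub>\<le>\<^sub>0" for t
      using Re_r [of t] by (auto simp: complex_nonpos_Reals_iff)
  qed
  ultimately show "winding_number (\<lambda>t. marking (point_loop t)) 0 = - 1"
    by (simp add: add_eq_0_iff2)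
  have fst: "punctured_loop (\<lambda>t. fst (point_loop t))" and snd: "punctured_loop (\<lambda>t. snd (point_loop t))"
    by (rule punctured_loop_compose [OF path loop image];
        auto simp: mem_torus intro: continuous_intros)+
  have "winding_number (\<lambda>t. fst (point_loop t)) 0 =
      winding_number (\<lambda>t. (- 1) * cis (sin (2 * pi * t))) 0"
    by (simp add: point_loop_def)
  also have "\<dots> = 0"
  proof -
    have p: "punctured_loop (\<lambda>t. cis (sin (2 * pi * t)))"
      by (auto simp: punctured_loop_iff intro!: continuous_intros)
    moreover have "winding_number (\<lambda>t. cis (sin (2 * pi * t))) 0 = 0"
    proof (rule winding_number_slit_plane [OF p])
      show "cis (sin (2 * pi * t)) \<notin> \<real>\<^sub>\<le>\<^sub>0" for t
        using cos_pos_abs_le_1 [of "sin (2 * pi * t)"] by (simp add: complex_nonpos_Reals_iff)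
    qed
    ultimately show ?thesis
      using winding_number_mult [OF winding_number_const_loop(1) p, of "- 1"]
        winding_number_const_loop(2) [of "- 1"] by simp
  qed
  finally show "winding_number (\<lambda>t. fst (point_loop t)) 0 = 0" .
  show "winding_number (\<lambda>t. snd (point_loop t)) 0 = 0"
  proof (rule winding_number_slit_plane [OF snd])
    show "snd (point_loop t) \<notin> \<real>\<^sub>\<le>\<^sub>0" for t
      using cos_pos_abs_le_1 [of "cos (2 * pi * t)"]
      by (simp add: complex_nonpos_Reals_iff point_loop_def)
  qed
qed

section \<open>Parity of winding numbers along the loops of the graph\<close>

lemma finite_root_pt: "finite (root_pt N ` {..<N})" "root_pt N ` {..<N} \<subseteq> sphere 0 1"
  by (auto simp: root_pt_def)

lemma compact_loop_graph: "compact (loop_graph N)"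
  unfolding loop_graph_def using finite_root_pt
  by (intro compact_Un compact_Times finite_imp_compact compact_sphere) auto

text \<open>A function with even winding numbers on all the loops of the graph has a square root there, and
  hence, up to homotopy, wherever the graph is a deformation retract.\<close>

lemma even_winding_number_retract:
  fixes \<iota> :: "complex \<times> complex \<Rightarrow> torus_pt"
  assumes \<iota>: "continuous_on (loop_graph N) \<iota>" "inj_on \<iota> (loop_graph N)"
    and r: "deformation_retraction S (\<iota> ` loop_graph N) r"
    and \<psi>: "continuous_on S \<psi>" "\<And>p. p \<in> S \<Longrightarrow> \<psi> p \<noteq> 0"
    and circle: "winding_number (\<lambda>t. \<psi> (\<iota> (cis (2 * pi * t), 1))) 0 = 2 * of_int n"
    and loops: "\<And>j. j < N \<Longrightarrow> winding_number (\<lambda>t. \<psi> (\<iota> (root_pt N j, cis (2 * pi * t)))) 0 = 2 * of_int (m j)"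
    and \<gamma>: "path \<gamma>" "pathfinish \<gamma> = pathstart \<gamma>" "path_image \<gamma> \<subseteq> S"
  obtains l :: int where "winding_number (\<lambda>t. \<psi> (\<gamma> t)) 0 = 2 * of_int l"
proof -
  let ?K = "loop_graph N"
  have retr: "\<iota> ` ?K \<subseteq> S" "continuous_on S r" "r \<in> S \<rightarrow> \<iota> ` ?K"
    and hom: "homotopic_with_canon (\<lambda>_. True) S S id r"
    using r by (auto simp: deformation_retraction_def retraction_def)
  \<comment> \<open>\<open>loops_on_circle_sqrt\<close> names the attached loops by their base
    points instead of by numbers, so the integers \<open>m j\<close> are transferred along
    \<open>root_pt\<close>.\<close>
  have "\<exists>k. \<forall>j<N. winding_number (\<lambda>t. \<psi> (\<iota> (root_pt N j, cis (2 * pi * t)))) 0 = 2 * of_int (k (root_pt N j))"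
  proof (intro exI allI impI)
    fix j assume "j < N"
    then have ex: "\<exists>j'. j' < N \<and> root_pt N j' = root_pt N j"
      by blast
    show "winding_number (\<lambda>t. \<psi> (\<iota> (root_pt N j, cis (2 * pi * t)))) 0 =
        2 * of_int ((\<lambda>z. m (SOME j'. j' < N \<and> root_pt N j' = z)) (root_pt N j))"
      using loops [of "SOME j'. j' < N \<and> root_pt N j' = root_pt N j"] someI_ex [OF ex] by simp
  qed
  then obtain k where k: "\<And>z. z \<in> root_pt N ` {..<N} \<Longrightarrow>
      winding_number (\<lambda>t. \<psi> (\<iota> (z, cis (2 * pi * t)))) 0 = 2 * of_int (k z)"
    by auto
  have "continuous_on ?K (\<lambda>q. \<psi> (\<iota> q))"
    by (rule continuous_on_compose2 [OF \<psi>(1) \<iota>(1) retr(1)])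
  moreover have "\<psi> (\<iota> q) \<noteq> 0" if "q \<in> ?K" for q
    using \<psi>(2) retr(1) that by blast
  ultimately obtain \<sigma> where \<sigma>: "continuous_on ?K \<sigma>" "\<And>q. q \<in> ?K \<Longrightarrow> \<sigma> q ^ 2 = \<psi> (\<iota> q)"
    using loops_on_circle_sqrt [OF finite_root_pt, of N "\<lambda>q. \<psi> (\<iota> q)" n k] circle k
    unfolding loop_graph_def by blast
  obtain \<kappa> where \<kappa>: "homeomorphism ?K (\<iota> ` ?K) \<iota> \<kappa>"
    using homeomorphism_compact [OF compact_loop_graph \<iota>(1) _ \<iota>(2)] by blast
  \<comment> \<open>The root found on the graph is evaluated along the retracted loop, so
    \<open>\<psi>\<close> winds there twice as often as \<open>\<rho>\<close>.\<close>
  define \<rho> where "\<rho> = (\<lambda>t. \<sigma> (\<kappa> (r (\<gamma> t))))"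
  have r\<gamma>: "r p \<in> \<iota> ` ?K" if "p \<in> S" for p
    using retr(3) that by blast
  have \<kappa>r: "\<kappa> (r p) \<in> ?K" "\<iota> (\<kappa> (r p)) = r p" if "p \<in> S" for p
    using r\<gamma> [OF that] \<kappa> by (auto simp: homeomorphism_def)
  have sq: "\<rho> t ^ 2 = \<psi> (r (\<gamma> t))" if "t \<in> {0..1}" for t
    using \<sigma>(2) \<kappa>r \<gamma>(3) that by (auto simp: \<rho>_def path_image_def image_subset_iff)
  have "continuous_on S (\<lambda>p. \<kappa> (r p))"
    by (rule continuous_on_compose2 [OF homeomorphism_cont2 [OF \<kappa>] retr(2)]) (use r\<gamma> in blast)
  then have "continuous_on S (\<lambda>p. \<sigma> (\<kappa> (r p)))"
    by (rule continuous_on_compose2 [OF \<sigma>(1)]) (use \<kappa>r in auto)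
  moreover have "\<sigma> (\<kappa> (r p)) \<noteq> 0" if "p \<in> S" for p
  proof -
    have "r p \<in> S"
      using r\<gamma> [OF that] retr(1) by blast
    then have "\<sigma> (\<kappa> (r p)) ^ 2 \<noteq> 0"
      using \<sigma>(2) [OF \<kappa>r(1) [OF that]] \<kappa>r(2) [OF that] \<psi>(2) by simp
    then show ?thesis
      by auto
  qed
  ultimately have \<rho>: "punctured_loop \<rho>"
    unfolding \<rho>_def by (rule punctured_loop_compose [OF \<gamma>])
  obtain l :: int where l: "winding_number \<rho> 0 = of_int l"
    using punctured_loop_winding_number_int [OF \<rho>] .
  have "homotopic_loops S (id \<circ> \<gamma>) (r \<circ> \<gamma>)"
    by (rule homotopic_loops_compose [OF hom \<gamma>])
  from winding_number_homotopic_compose [OF this \<psi>]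
  have "winding_number (\<lambda>t. \<psi> (\<gamma> t)) 0 = winding_number (\<lambda>t. \<psi> (r (\<gamma> t))) 0"
    by simp
  also have "\<dots> = winding_number (\<lambda>t. \<rho> t ^ 2) 0"
    by (rule winding_number_cong) (use sq in auto)
  also have "\<dots> = 2 * of_int l"
    using winding_number_power [OF \<rho>, of 2] l by simp
  finally show thesis
    by (rule that)
qed

text \<open>If all vertical loops had the same parity, \<open>marking\<close> times suitable powers
  of the coordinates would wind evenly along every loop of the graph. It would then wind evenly
  along \<open>point_loop\<close>, where its winding number is \<open>- 1\<close>.\<close>

lemma axis_embedding_marking_odd:
  assumes emb: "axis_embedding a b N \<iota>" and "\<bar>fst a\<bar> = 1" "fst b = 0" "\<bar>snd b\<bar> = 1"
    and r: "deformation_retraction (torus - twist_orbit 1) (\<iota> ` loop_graph N) r"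
    and d: "\<And>j. j < N \<Longrightarrow> winding_number (\<lambda>t. marking (\<iota> (root_pt N j, cis (2 * pi * t)))) 0 = of_int (d j)"
  shows "\<exists>j<N. odd (d j + d 0)"
proof (rule ccontr)
  assume "\<not> (\<exists>j<N. odd (d j + d 0))"
  then have even: "even (d j + d 0)" if "j < N" for j
    using that by blast
  let ?S = "torus - twist_orbit 1"
  have \<iota>: "continuous_on (loop_graph N) \<iota>" "inj_on \<iota> (loop_graph N)"
    and hor: "has_class (\<lambda>t. \<iota> (cis (2 * pi * t), 1)) a"
    and ver: "\<And>j. j < N \<Longrightarrow> has_class (\<lambda>t. \<iota> (root_pt N j, cis (2 * pi * t))) b"
    using emb by (auto simp: axis_embedding_def)
  have sub: "\<iota> ` loop_graph N \<subseteq> ?S"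
    using r by (auto simp: deformation_retraction_def retraction_def)
  have nz: "fst p \<noteq> 0" "snd p \<noteq> 0" "marking p \<noteq> 0" if "p \<in> ?S" for p
    using that marking_eq_0_iff by (auto simp: mem_torus)
  have wn: "winding_number (\<lambda>t. marking (\<gamma> t) * (snd (\<gamma> t) ^ J * fst (\<gamma> t) ^ I)) 0 =
      winding_number (\<lambda>t. marking (\<gamma> t)) 0 +
      (of_nat J * winding_number (\<lambda>t. snd (\<gamma> t)) 0 + of_nat I * winding_number (\<lambda>t. fst (\<gamma> t)) 0)"
    and mark: "punctured_loop (\<lambda>t. marking (\<gamma> t))"
    if \<gamma>: "path \<gamma>" "pathfinish \<gamma> = pathstart \<gamma>" "path_image \<gamma> \<subseteq> ?S" for \<gamma> I J
  proof -
    have m: "punctured_loop (\<lambda>t. marking (\<gamma> t))"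
      by (rule punctured_loop_compose [OF \<gamma> continuous_on_marking nz(3)])
    have f: "punctured_loop (\<lambda>t. fst (\<gamma> t))" and s: "punctured_loop (\<lambda>t. snd (\<gamma> t))"
      by (rule punctured_loop_compose [OF \<gamma>]; use nz in \<open>auto intro: continuous_intros\<close>)+
    note f = winding_number_power [OF f, of I] and s = winding_number_power [OF s, of J]
    show "punctured_loop (\<lambda>t. marking (\<gamma> t))"
      by (rule m)
    show "winding_number (\<lambda>t. marking (\<gamma> t) * (snd (\<gamma> t) ^ J * fst (\<gamma> t) ^ I)) 0 =
      winding_number (\<lambda>t. marking (\<gamma> t)) 0 +
      (of_nat J * winding_number (\<lambda>t. snd (\<gamma> t)) 0 + of_nat I * winding_number (\<lambda>t. fst (\<gamma> t)) 0)"
      using winding_number_mult [OF m punctured_loop_mult [OF conjunct1 [OF s] conjunct1 [OF f]]]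
        winding_number_mult [OF conjunct1 [OF s] conjunct1 [OF f]] conjunct2 [OF s] conjunct2 [OF f]
      by simp
  qed
  have "(cis (2 * pi * t), 1) \<in> loop_graph N" for t
    by (auto simp: loop_graph_def)
  then have H: "path_image (\<lambda>t. \<iota> (cis (2 * pi * t), 1)) \<subseteq> ?S"
    using sub by (auto simp: path_image_def)
  have "(root_pt N j, cis (2 * pi * t)) \<in> loop_graph N" if "j < N" for j t
    using that by (auto simp: loop_graph_def)
  then have L: "path_image (\<lambda>t. \<iota> (root_pt N j, cis (2 * pi * t))) \<subseteq> ?S" if "j < N" for j
    using sub that by (auto simp: path_image_def)
  have loopH: "path (\<lambda>t. \<iota> (cis (2 * pi * t), 1))"
    "pathfinish (\<lambda>t. \<iota> (cis (2 * pi * t), 1)) = pathstart (\<lambda>t. \<iota> (cis (2 * pi * t), 1))"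
    using hor by (simp_all only: has_class_iff)
  have loopL: "path (\<lambda>t. \<iota> (root_pt N j, cis (2 * pi * t)))"
    "pathfinish (\<lambda>t. \<iota> (root_pt N j, cis (2 * pi * t))) = pathstart (\<lambda>t. \<iota> (root_pt N j, cis (2 * pi * t)))"
    if "j < N" for j
    using ver [OF that] by (simp_all only: has_class_iff)
  obtain h :: int where h: "winding_number (\<lambda>t. marking (\<iota> (cis (2 * pi * t), 1))) 0 = of_int h"
    using punctured_loop_winding_number_int [OF mark [OF loopH H]] .
  have odd_ab: "odd (fst a)" "odd (snd b)"
    using assms(2,4) by (auto simp: abs_if split: if_splits)
  \<comment> \<open>\<open>J\<close> corrects the vertical loops, all at once because their parities
    agree and \<open>snd\<close> winds an odd number of times on each. \<open>I\<close> then
    corrects the horizontal loop and leaves the vertical ones alone, since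
    \<open>fst b = 0\<close>.\<close>
  define J :: nat where "J = (if even (d 0) then 0 else 1)"
  define I :: nat where "I = (if even (h + int J * snd a) then 0 else 1)"
  define \<psi> where "\<psi> = (\<lambda>p. marking p * (snd p ^ J * fst p ^ I))"
  have evenH: "even (h + (int J * snd a + int I * fst a))"
    using odd_ab(1) by (auto simp: I_def)
  have evenL: "even (d j + (int J * snd b + int I * fst b))" if "j < N" for j
    using odd_ab(2) even [OF that] \<open>fst b = 0\<close> by (auto simp: J_def)
  obtain l :: int where "winding_number (\<lambda>t. \<psi> (point_loop t)) 0 = 2 * of_int l"
  proof (rule even_winding_number_retract [OF \<iota> r, where \<psi> = \<psi> and \<gamma> = point_loop])
    show "continuous_on ?S \<psi>"
      unfolding \<psi>_def by (intro continuous_intros continuous_on_marking)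
    show "\<psi> p \<noteq> 0" if "p \<in> ?S" for p
      using nz [OF that] by (simp add: \<psi>_def)
    show "winding_number (\<lambda>t. \<psi> (\<iota> (cis (2 * pi * t), 1))) 0 =
        2 * of_int ((h + (int J * snd a + int I * fst a)) div 2)"
    proof -
      have "winding_number (\<lambda>t. \<psi> (\<iota> (cis (2 * pi * t), 1))) 0 =
          of_int (h + (int J * snd a + int I * fst a))"
        unfolding \<psi>_def wn [OF loopH H] h using has_class_winding_numbers(3,4) [OF hor] by simp
      also have "\<dots> = of_int (2 * ((h + (int J * snd a + int I * fst a)) div 2))"
        using evenH by (simp only: dvd_mult_div_cancel)
      finally show ?thesis
        by simp
    qed
    show "winding_number (\<lambda>t. \<psi> (\<iota> (root_pt N j, cis (2 * pi * t)))) 0 =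
        2 * of_int ((d j + (int J * snd b + int I * fst b)) div 2)" if "j < N" for j
    proof -
      have "winding_number (\<lambda>t. \<psi> (\<iota> (root_pt N j, cis (2 * pi * t)))) 0 =
          of_int (d j + (int J * snd b + int I * fst b))"
        unfolding \<psi>_def wn [OF loopL [OF that] L [OF that]] d [OF that]
        using has_class_winding_numbers(3,4) [OF ver [OF that]] by simp
      also have "\<dots> = of_int (2 * ((d j + (int J * snd b + int I * fst b)) div 2))"
        using evenL [OF that] by (simp only: dvd_mult_div_cancel)
      finally show ?thesis
        by simp
    qed
  qed (use point_loop in auto)
  moreover have "winding_number (\<lambda>t. \<psi> (point_loop t)) 0 = - 1"
    unfolding \<psi>_def wn [OF point_loop(1-3)] point_loop(4-6) by simp
  ultimately have "of_int (2 * l) = (of_int (- 1) :: complex)"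
    by simp
  then have "2 * l = - 1"
    by (simp only: of_int_eq_iff)
  then show False
    by presburger
qed

section \<open>Loops in the complement of the orbit\<close>

text \<open>Each stage of the isotopy is injective on the torus and takes \<open>x\<close> onto
  \<open>x\<close>, so it takes no other point into \<open>x\<close>.\<close>

lemma homotopic_complement:
  assumes "isotopic_rel x f g" "f ` x = x" "x \<subseteq> torus"
  shows "homotopic_with_canon (\<lambda>_. True) (torus - x) (torus - x) f g"
proof -
  obtain h where h: "continuous_map (prod_topology (top_of_set {0..1::real}) (top_of_set torus)) (top_of_set torus) h"
    "\<And>p. h (0, p) = f p" "\<And>p. h (1, p) = g p"
    and P: "\<And>t. t \<in> {0..1} \<Longrightarrow> torus_homeo (\<lambda>p. h (t, p)) \<and> (\<forall>z\<in>x. h (t, z) = f z)"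
    using assms(1) unfolding isotopic_rel_def homotopic_with_def by blast
  have cont: "continuous_on ({0..1} \<times> torus) h" and im: "h ` ({0..1} \<times> torus) \<subseteq> torus"
    using h(1) by auto
  have "h (t, p) \<in> torus - x" if t: "t \<in> {0..1}" and p: "p \<in> torus - x" for t p
  proof -
    have "h (t, p) \<notin> x"
    proof
      assume "h (t, p) \<in> x"
      then obtain z where z: "z \<in> x" "h (t, p) = h (t, z)"
        using assms(2) P [OF t] by (metis imageE)
      have "inj_on (\<lambda>p. h (t, p)) torus"
        using P [OF t] unfolding torus_homeo_def homeomorphism_def by (metis inj_on_inverseI)
      then have "p = z"
        using z p assms(3) by (auto dest: inj_onD)
      with z p show False
        by blast
    qed
    then show ?thesis
      using im t p by blast
  qed
  moreover have "continuous_on ({0..1} \<times> (torus - x)) h"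
    using cont by (rule continuous_on_subset) auto
  ultimately have "continuous_map (prod_topology (top_of_set {0..1}) (top_of_set (torus - x))) (top_of_set (torus - x)) h"
    by auto
  then show ?thesis
    unfolding homotopic_with_def using h(2,3) by blast
qed

lemma shear_map_image_twist_orbit: "shear_map ` twist_orbit 1 = twist_orbit 1"
  using shear_map_twist_orbit [of 1] shear_map_twist_orbit [of "- 1"] by (auto simp: twist_orbit_def)

lemma twist_orbit_subset: "twist_orbit 1 \<subseteq> torus"
  by (auto simp: twist_orbit_def mem_torus)

text \<open>The flow fixes \<open>z = - 1\<close>, so reducing its time to 0 leaves the images of
  the orbit points unchanged.\<close>

lemma isotopic_rel_shear_map: "isotopic_rel (twist_orbit 1) shear_map (shear 0 1)"
proof -
  have "isotopic_rel (twist_orbit 1) (shear (1 - 0) 1) (shear (1 - 1) 1)"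
  proof (rule isotopic_rel_shear [of "\<lambda>t. 1 - t" "\<lambda>_. 1"])
    show "shear (1 - t) 1 p = shear (1 - 0) 1 p" if "p \<in> twist_orbit 1" for t p
      using that by (auto simp: twist_orbit_def shear_def)
  qed (auto intro!: continuous_intros)
  then show ?thesis
    by simp
qed

text \<open>The shear acts by \<open>-1\<close> on the winding number of \<open>marking\<close> along vertical loops, because it
  exchanges the two points of the orbit.\<close>

lemma winding_number_marking_isotopic:
  assumes iso: "isotopic_rel (twist_orbit 1) shear_map f'"
    and \<gamma>: "has_class \<gamma> b" "fst b = 0" "path_image \<gamma> \<subseteq> torus - twist_orbit 1"
  shows "winding_number (\<lambda>t. marking (f' (\<gamma> t))) 0 = - winding_number (\<lambda>t. marking (\<gamma> t)) 0"
proof -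
  let ?S = "torus - twist_orbit 1"
  have loop: "path \<gamma>" "pathfinish \<gamma> = pathstart \<gamma>"
    using \<gamma>(1) by (simp_all only: has_class_iff)
  have nz: "marking p \<noteq> 0" if "p \<in> ?S" for p
    using that marking_eq_0_iff by blast
  have mark: "punctured_loop (\<lambda>t. marking (\<gamma> t))"
    by (rule punctured_loop_compose [OF loop \<gamma>(3) continuous_on_marking nz])
  have \<gamma>t: "\<gamma> t \<in> torus" if "t \<in> {0..1}" for t
    using \<gamma>(3) that unfolding path_image_def by blast
  then have norm: "norm (fst (\<gamma> t)) = 1" if "t \<in> {0..1}" for t
    using that mem_torus by blast
  note fst = has_class_winding_numbers(1,3) [OF \<gamma>(1)]
  note tw = winding_number_twist_factor [OF fst(1) norm]
  note hom = homotopic_complement [OF _ shear_map_image_twist_orbit twist_orbit_subset]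
  have "homotopic_loops ?S (shear_map \<circ> \<gamma>) (f' \<circ> \<gamma>)" "homotopic_loops ?S (shear_map \<circ> \<gamma>) (shear 0 1 \<circ> \<gamma>)"
    using homotopic_loops_compose [OF hom loop \<gamma>(3)] iso isotopic_rel_shear_map by blast+
  then have "homotopic_loops ?S (f' \<circ> \<gamma>) (shear 0 1 \<circ> \<gamma>)"
    using homotopic_loops_sym homotopic_loops_trans by blast
  from winding_number_homotopic_compose [OF this continuous_on_marking nz]
  have "winding_number (\<lambda>t. marking (f' (\<gamma> t))) 0 = winding_number (\<lambda>t. marking (shear 0 1 (\<gamma> t))) 0"
    by simp
  also have "\<dots> = winding_number (\<lambda>t. cnj (marking (\<gamma> t)) * twist_factor (fst (\<gamma> t))) 0"
    by (rule winding_number_cong) (use marking_shear \<gamma>t in auto)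
  \<comment> \<open>Conjugation gives the sign, and \<open>twist_factor\<close> contributes
    \<open>fst b\<close>, which is 0.\<close>
  also have "\<dots> = - winding_number (\<lambda>t. marking (\<gamma> t)) 0"
    using winding_number_mult [OF conjunct1 [OF winding_number_cnj_loop [OF mark]] tw(1)]
      winding_number_cnj_loop [OF mark] tw(2) fst(2) \<gamma>(2) by simp
  finally show ?thesis .
qed

text \<open>The action on the graph gives \<open>d (j + k) = - d j\<close>. For \<open>k = 0\<close>
  both integers vanish, and for \<open>k = 1\<close> they are negatives of each other; either way
  their parities agree, against \<open>axis_embedding_marking_odd\<close>.\<close>

lemma not_simple_orbit_shear_map:
  assumes "standard_axes a b shear_map"
  shows "\<not> simple_orbit a b (twist_orbit 1) shear_map"
proof
  assume simple: "simple_orbit a b (twist_orbit 1) shear_map"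
  have "card (twist_orbit 1) = 2"
    by (simp add: twist_orbit_def)
  from simple [unfolded simple_orbit_def this Let_def] show False
  proof (elim exE conjE)
    fix \<iota> r0 f' U V r k m M
    assume emb: "axis_embedding a b 2 \<iota>"
      and r0: "deformation_retraction (torus - twist_orbit 1) (\<iota> ` loop_graph 2) r0"
      and iso: "isotopic_rel (twist_orbit 1) shear_map f'"
      and U: "\<iota> ` loop_graph 2 \<subseteq> V" "V \<subseteq> U" "U \<subseteq> torus - twist_orbit 1" "f' ` U = U"
      and r: "deformation_retraction U (\<iota> ` loop_graph 2) r"
      and "k < 2" and M: "simple_graph_map 2 k m M"
      and hom: "homotopic_with_canon (\<lambda>_. True) (loop_graph 2) (\<iota> ` loop_graph 2) (r \<circ> f' \<circ> \<iota>) (\<iota> \<circ> M)"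
    let ?S = "torus - twist_orbit 1"
    have ab: "\<bar>fst a\<bar> = 1" "fst b = 0" "\<bar>snd b\<bar> = 1"
      using assms by (auto simp: standard_axes_shear_map)
    define L where "L = (\<lambda>j t. \<iota> (root_pt 2 j, cis (2 * pi * t)))"
    have vertical: "has_class (L j) b" if "j < 2" for j
      using emb that by (simp add: axis_embedding_def L_def)
    have graph: "(root_pt 2 j, cis (2 * pi * t)) \<in> loop_graph 2" if "j < 2" for j t
      using that by (auto simp: loop_graph_def)
    then have LU: "L j t \<in> U" if "j < 2" for j t
      using that U(1,2) unfolding L_def by blast
    then have image: "path_image (L j) \<subseteq> U" if "j < 2" for j
      using that by (auto simp: path_image_def)
    have nz: "marking p \<noteq> 0" if "p \<in> ?S" for p
      using that marking_eq_0_iff by blast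
    define d where "d = (\<lambda>j. SOME n :: int. winding_number (\<lambda>t. marking (L j t)) 0 = of_int n)"
    have d: "winding_number (\<lambda>t. marking (L j t)) 0 = of_int (d j)" if "j < 2" for j
    proof -
      have "punctured_loop (\<lambda>t. marking (L j t))"
        by (rule punctured_loop_compose [OF _ _ _ continuous_on_marking nz])
          (use vertical [OF that] image [OF that] U(3) in \<open>auto simp: has_class_iff\<close>)
      then show ?thesis
        unfolding d_def by (metis (mono_tags, lifting) punctured_loop_winding_number_int someI_ex)
    qed
    have step: "winding_number (\<lambda>t. marking (L (j + k) t)) 0 = - of_int (d j)" if j: "j < 2" for j
    proof -
      have loop: "path (L j)" "pathfinish (L j) = pathstart (L j)"
        using vertical [OF j] by (simp_all only: has_class_iff)
      have f'S: "homotopic_with_canon (\<lambda>_. True) ?S ?S shear_map f'"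
        by (rule homotopic_complement [OF iso shear_map_image_twist_orbit twist_orbit_subset])
      have "continuous_on U f'"
        using homotopic_with_imp_continuous [OF f'S] U(3) continuous_on_subset by blast
      then have f'L: "path (f' \<circ> L j)"
        using loop(1) image [OF j] by (meson continuous_on_subset path_continuous_image)
      have f'L_image: "path_image (f' \<circ> L j) \<subseteq> U"
        using LU [OF j] U(4) by (auto simp: path_image_def)
      have f'L_loop: "pathfinish (f' \<circ> L j) = pathstart (f' \<circ> L j)"
        using loop(2) by (simp add: pathfinish_def pathstart_def)
      \<comment> \<open>Invariance of \<open>U\<close> keeps the image loop where \<open>r\<close>
        retracts. Retracting it onto the graph and then replacing the induced action by
        \<open>M\<close> are both homotopies in the complement of the orbit.\<close>
      have "homotopic_with_canon (\<lambda>_. True) U U id r"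
        using r by (simp add: deformation_retraction_def)
      then have "homotopic_loops U (id \<circ> (f' \<circ> L j)) (r \<circ> (f' \<circ> L j))"
        by (rule homotopic_loops_compose [OF _ f'L f'L_loop f'L_image])
      then have 1: "homotopic_loops ?S (f' \<circ> L j) (r \<circ> (f' \<circ> L j))"
        using U(3) by (simp add: homotopic_loops_subset)
      let ?c = "\<lambda>t. (root_pt 2 j, cis (2 * pi * t))"
      have "homotopic_loops (\<iota> ` loop_graph 2) ((r \<circ> f' \<circ> \<iota>) \<circ> ?c) ((\<iota> \<circ> M) \<circ> ?c)"
      proof (rule homotopic_loops_compose [OF hom])
        show "path ?c"
          unfolding path_def by (intro continuous_intros)
        show "path_image ?c \<subseteq> loop_graph 2"
          using graph [OF j] by (auto simp: path_image_def)
      qed (simp add: pathfinish_def pathstart_def)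
      moreover have "(r \<circ> f' \<circ> \<iota>) \<circ> ?c = r \<circ> (f' \<circ> L j)"
        by (auto simp: L_def)
      moreover have "(\<iota> \<circ> M) \<circ> ?c = L (j + k)"
        using M j by (auto simp: simple_graph_map_def L_def)
      moreover have "\<iota> ` loop_graph 2 \<subseteq> ?S"
        using U(1-3) by blast
      ultimately have "homotopic_loops ?S (r \<circ> (f' \<circ> L j)) (L (j + k))"
        using homotopic_loops_subset by metis
      with 1 have "homotopic_loops ?S (f' \<circ> L j) (L (j + k))"
        by (rule homotopic_loops_trans)
      from winding_number_homotopic_compose [OF this continuous_on_marking nz]
      have "winding_number (\<lambda>t. marking (L (j + k) t)) 0 = winding_number (\<lambda>t. marking (f' (L j t))) 0"
        by simp
      also have "\<dots> = - of_int (d j)"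
        using winding_number_marking_isotopic [OF iso vertical [OF j] ab(2)] image [OF j] U(3) d [OF j] by auto
      finally show ?thesis .
    qed
    \<comment> \<open>The index \<open>j + k\<close> is not reduced modulo 2, so the relation is
      restricted to the cases where it still numbers a loop below 2.\<close>
    have dk: "d (j + k) = - d j" if "j < 2" "j + k < 2" for j
      using step [OF that(1)] d [OF that(2)] by (metis of_int_eq_iff of_int_minus)
    obtain j where j: "j < 2" "odd (d j + d 0)"
      using axis_embedding_marking_odd [OF emb ab r0, of d] d unfolding L_def by blast
    then have "j = 1"
      by (cases "j = 0") auto
    consider "k = 0" | "k = 1"
      using \<open>k < 2\<close> by linarith
    then show False
    proof cases
      case 1
      then have "d 0 = 0" "d 1 = 0"
        using dk [of 0] dk [of 1] by auto
      with j \<open>j = 1\<close> show False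
        by simp
    next
      case 2
      then have "d 1 = - d 0"
        using dk [of 0] by simp
      with j \<open>j = 1\<close> show False
        by simp
    qed
  qed
qed

theorem lemma2p4:
  shows "\<exists>f x. shear_type f \<and> (\<exists>a b. standard_axes a b f) \<and> periodic_orbit f x \<and>
           (\<forall>a b. standard_axes a b f \<longrightarrow> twist_type a b x f \<and> \<not> simple_orbit a b x f)"
proof (intro exI conjI allI impI)
  show "shear_type shear_map"
    by (rule shear_type_shear_map)
  show "standard_axes (1, 0) (0, 1) shear_map"
    by (simp add: standard_axes_shear_map)
  show "periodic_orbit shear_map (twist_orbit 1)"
    unfolding periodic_orbit_shear_map by (rule exI [of _ 1]) simp
qed (rule twist_type_shear_map, rule not_simple_orbit_shear_map)

end
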